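(* Let $p_1<p_2<\ldots$ be the sequence of all primes and let $$E=\left\{\prod_{1\le i\le k,\ i\ne j}p_i:\ k=2,3,\ldots,\ 1\le j\le k\right\}.$$ Let $$\Phi(x)=\frac{x\ln(1+x)}{\ln\ln(3+x)},\qquad x\ge 0.$$ Then for any $f\in L^\Phi(\mathbb{T})$ we have $$\lim_{n\to\infty,\ n\in E}R_nf(x)=\int_0^1 f(t)\,dt\quad\text{for almost every }x\in\mathbb{T}.$$ Moreover, there is an absolute constant $c>0$ such that for any $f\in L^\Phi(\mathbb{T})$ $$\left|\left\{x\in\mathbb{T}:\ \sup_{n\in E}|R_nf(x)|>\lambda\right\}\right|\le\int_0^1\Phi\left(\frac{c|f(t)|}{\lambda}\right)dt,\qquad\lambda>0.$$
   Context: $\mathbb{T}=\mathbb{R}/\mathbb{Z}=[0,1)$ is the torus with Lebesgue measure $|\cdot|$. For a function $f$ on $\mathbb{T}$ and a positive integer $n$, $R_nf(x)=\frac1n\sum_{k=0}^{n-1}f\left(x+\frac kn\right)$. $L^\Phi(\mathbb{T})$ denotes the class of (measurable) functions $f$ on $\mathbb{T}$ with $\Phi(|f|)\in L^1(\mathbb{T})$. *)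

theory Defs
  imports "HOL-Analysis.Analysis" "HOL-Computational_Algebra.Primes" "HOL-Library.Infinite_Set"
begin

text \<open>
  The torus is modelled as \<open>[0,1)\<close> with the (complete) Lebesgue measure. A function on the torus
  is a function on the reals of which only the values on \<open>[0,1)\<close> are ever used; addition
  on the torus is addition of reals followed by \<^const>\<open>frac\<close>.
\<close>

definition torus :: "real measure" where
  "torus = lebesgue_on {0..<1}"

definition riemann_mean :: "nat \<Rightarrow> (real \<Rightarrow> complex) \<Rightarrow> real \<Rightarrow> complex" where
  "riemann_mean n f x = (\<Sum>k<n. f (frac (x + real k / real n))) / of_nat n"

definition orlicz_class :: "(real \<Rightarrow> real) \<Rightarrow> (real \<Rightarrow> complex) set" where
  "orlicz_class \<Psi> = {f \<in> borel_measurable torus. integrable torus (\<lambda>x. \<Psi> (norm (f x)))}"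

text \<open>\<^const>\<open>enumerate\<close> counts from \<open>0\<close>, whereas \<open>nth_prime\<close> counts from \<open>1\<close>: \<open>nth_prime 1 = 2\<close>.\<close>

definition nth_prime :: "nat \<Rightarrow> nat" where
  "nth_prime i = enumerate {p. prime p} (i - 1)"

definition punctured_primorials :: "nat set" where
  "punctured_primorials =
     {\<Prod>i\<in>{i. 1 \<le> i \<and> i \<le> k \<and> i \<noteq> j}. nth_prime i | k j. 2 \<le> k \<and> 1 \<le> j \<and> j \<le> k}"

definition Phi :: "real \<Rightarrow> real" where
  "Phi x = x * ln (1 + x) / ln (ln (3 + x))"

end

theory Submission imports Defs begin

text \<open>
  Write \<open>P\<^sub>k\<close> for the product of the first \<open>k\<close> primes. A fibre \<open>{x + l / P\<^sub>K}\<close> is a product of cyclic groups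
  of prime order, on which the mean over \<open>P\<^sub>k / p\<^sub>j\<close> translates is the conditional expectation given the
  \<open>j\<close>-th coordinate and those above \<open>k\<close>. For \<open>f \<ge> 0\<close>, record for each \<open>j\<close> the first \<open>k\<close>, in descending
  order, for which this mean exceeds 1. As the \<open>j\<close>-th coordinate is independent of the
  others, the number \<open>g\<close> of recorded events is a counting process; stopped when its compensator
  exceeds 1, it has Poisson tails, \<open>E ((1 + \<kappa>)\<^sup>g - 1) \<le> \<kappa> exp (2 \<kappa>) E g\<close>. Testing \<open>f\<close> against the events gives
  \<open>E g \<le> E (f g)\<close>, and Young's inequality for \<open>Phi\<close> and the Poisson-type weight \<open>m\<^sup>m\<close> yields
  \<open>E g \<le> E (Phi (c f))\<close> up to a constant, hence the weak type bound, first on every fibre and then on the torus.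
  Convergence follows by approximating with bounded, and bounded functions with continuous, functions.
\<close>

subsection \<open>Averages over equally spaced translates\<close>

definition periodic :: "nat \<Rightarrow> (real \<Rightarrow> 'a) \<Rightarrow> bool" where
  "periodic n F \<longleftrightarrow> (\<forall>x. F (x + 1 / real n) = F x)"

definition avg :: "nat \<Rightarrow> (real \<Rightarrow> 'a::real_normed_field) \<Rightarrow> real \<Rightarrow> 'a" where
  "avg n F x = (\<Sum>k<n. F (x + real k / real n)) / of_nat n"

lemma periodicD_nat: "periodic n F \<Longrightarrow> F (x + real k / real n) = F x"
proof (induction k)
  case (Suc k)
  have "F (x + real (Suc k) / real n) = F ((x + real k / real n) + 1 / real n)"
    by (simp add: add_divide_distrib algebra_simps)
  then show ?case using Suc by (simp add: periodic_def)
qed simp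

lemma periodicD_int: 
  assumes "periodic n F" shows "F (x + of_int k / real n) = F x"
proof (cases "k \<ge> 0")
  case True
  then show ?thesis using periodicD_nat[OF assms, of x "nat k"] by simp
next
  case False
  then show ?thesis using periodicD_nat[OF assms, of "x + of_int k / real n" "nat (-k)"] by simp
qed

lemma periodic_dvd:
  assumes "periodic m F" "n dvd m" "m > 0" shows "periodic n F"
proof -
  obtain d where d: "m = n * d" using assms(2) by auto
  have "1 / real n = real d / real m" using d assms(3) by simp
  then show ?thesis unfolding periodic_def using periodicD_nat[OF assms(1), of _ d] by simp
qed

text \<open>Bezout's identity writes \<open>1 / (m * n)\<close> as an integer combination of the
  periods \<open>1 / m\<close> and \<open>1 / n\<close>.\<close>

lemma periodic_coprime_mult:
  assumes "periodic m F" "periodic n F" "coprime m n" "m > 0" "n > 0"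
  shows "periodic (m * n) F"
proof -
  obtain u v :: int where uv: "u * int m + v * int n = 1"
    using bezout_int[of "int m" "int n"] assms(3) by auto
  have "1 / real (m * n) = of_int v / real m + of_int u / real n"
  proof -
    have "real_of_int (u * int m + v * int n) = 1" by (simp only: uv of_int_1)
    then show ?thesis using assms(4,5) by (simp add: field_simps)
  qed
  then show ?thesis unfolding periodic_def
    by (metis add.assoc assms(1,2) periodicD_int)
qed

lemma periodic_comp: "periodic n F \<Longrightarrow> periodic n (\<lambda>x. h (F x))"
  by (simp add: periodic_def)

lemma periodic_comp2: "periodic n F \<Longrightarrow> periodic n G \<Longrightarrow> periodic n (\<lambda>x. h (F x) (G x))"
  by (simp add: periodic_def)

lemma periodic_sum: "(\<And>i. i \<in> I \<Longrightarrow> periodic n (F i)) \<Longrightarrow> periodic n (\<lambda>x. \<Sum>i\<in>I. F i x)"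
  by (simp add: periodic_def)

lemma avg_mono: fixes F :: "real \<Rightarrow> real" shows "(\<And>x. F x \<le> G x) \<Longrightarrow> avg n F x \<le> avg n G x"
  unfolding avg_def by (intro divide_right_mono sum_mono) auto

lemma avg_nonneg: fixes F :: "real \<Rightarrow> real" shows "(\<And>x. 0 \<le> F x) \<Longrightarrow> 0 \<le> avg n F x"
  unfolding avg_def by (simp add: sum_nonneg)

lemma avg_const: "n > 0 \<Longrightarrow> avg n (\<lambda>x. c) x = c"
  unfolding avg_def by simp

lemma avg_add: "avg n (\<lambda>x. F x + G x) x = avg n F x + avg n G x"
  unfolding avg_def by (simp add: sum.distrib add_divide_distrib)

lemma avg_cmult: "avg n (\<lambda>x. c * F x) x = c * avg n F x"
  unfolding avg_def by (simp add: sum_distrib_left)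

lemma avg_sum: "avg n (\<lambda>x. \<Sum>i\<in>I. F i x) x = (\<Sum>i\<in>I. avg n (F i) x)"
  unfolding avg_def by (simp add: sum.swap[of _ I] flip: sum_divide_distrib)

lemma avg_mult_periodic: 
  "periodic n H \<Longrightarrow> avg n (\<lambda>x. H x * F x) x = H x * avg n F x"
  unfolding avg_def by (simp add: periodicD_nat flip: sum_distrib_left)

lemma avg_periodic_id: "periodic n H \<Longrightarrow> n > 0 \<Longrightarrow> avg n H x = H x"
  unfolding avg_def by (simp add: periodicD_nat)

lemma periodic_avg: 
  assumes "periodic 1 F" "n > 0" shows "periodic n (avg n F)"
  unfolding periodic_def
proof
  fix x
  have "(\<Sum>k<n. F (x + 1 / real n + real k / real n)) = (\<Sum>k<n. F (x + real (Suc k) / real n))"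
    by (intro sum.cong) (auto simp: add_divide_distrib algebra_simps)
  also have "\<dots> = (\<Sum>k<Suc n. F (x + real k / real n)) - F x"
    by (subst sum.lessThan_Suc_shift) simp
  also have "\<dots> = (\<Sum>k<n. F (x + real k / real n))"
    using assms by (simp add: periodic_def)
  finally show "avg n F (x + 1 / real n) = avg n F x" by (simp add: avg_def)
qed

lemma avg_shift: "avg m (\<lambda>x. F (x + t)) x = avg m F (x + t)"
  unfolding avg_def by (simp add: algebra_simps)

lemma periodic_avg_other: "periodic m F \<Longrightarrow> periodic m (avg n F)"
proof -
  assume a: "periodic m F"
  then have "avg n (\<lambda>x. F (x + 1 / real m)) = avg n F" by (simp add: periodic_def)
  then show ?thesis by (simp add: periodic_def flip: avg_shift)
qed

text \<open>The tower property of conditional expectations. The two averages commute, and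
  \<open>avg m F\<close> already has period \<open>1 / n\<close>, so averaging it over
  \<open>n\<close> translates leaves it fixed.\<close>

lemma avg_avg_dvd:
  assumes "periodic 1 F" "n dvd m" "m > 0" shows "avg m (avg n F) x = avg m F x"
proof -
  have n: "n > 0" using assms dvd_pos_nat by blast
  have p: "periodic n (avg m F)"
    using periodic_avg[OF assms(1,3)] assms(2,3) periodic_dvd by blast
  have "avg m (avg n F) x = avg n (avg m F) x"
    by (simp add: avg_def sum_divide_distrib sum.swap[of _ "{..<n}"] algebra_simps)
  then show ?thesis using avg_periodic_id[OF p n] by simp
qed

text \<open>This expresses the independence of coordinates on a fibre: \<open>avg m F\<close> has
  the periods \<open>1 / m\<close> and \<open>1 / n\<close>, hence \<open>1 / (m * n)\<close>, so
  the average over all \<open>m * n\<close> translates fixes it.\<close>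

lemma avg_coprime:
  assumes "periodic 1 F" "periodic n F" "coprime m n" "m > 0" "n > 0"
  shows "avg (m * n) F x = avg m F x"
proof -
  have "periodic (m * n) (avg m F)"
    by (intro periodic_coprime_mult periodic_avg periodic_avg_other assms)
  then show ?thesis
    using avg_avg_dvd[OF assms(1), of m "m * n" x] assms avg_periodic_id[of "m * n" "avg m F"] by simp
qed

subsection \<open>The counting argument on a single fibre\<close>

text \<open>The terms kept before the last one add up to at most 1, and the last kept term, at which
  the level may be crossed, is itself at most 1.\<close>

lemma sum_stopped_le:
  fixes a :: "nat \<Rightarrow> real"
  assumes "\<And>i. 0 \<le> a i" "\<And>i. a i \<le> 1"
  shows "(\<Sum>i<n. of_bool ((\<Sum>l<i. a l) \<le> 1) * a i) \<le> 2"
proof (induction n)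
  case (Suc n)
  show ?case
  proof (cases "(\<Sum>l<n. a l) \<le> 1")
    case True
    have "(\<Sum>i<n. of_bool ((\<Sum>l<i. a l) \<le> 1) * a i) \<le> (\<Sum>l<n. a l)"
      using assms(1) by (intro sum_mono) auto
    then show ?thesis using True assms(2)[of n] by simp
  qed (use Suc in simp)
qed simp

text \<open>All terms up to the first crossing of level 1 are kept, so the stopped sum crosses it as
  well.\<close>

lemma sum_stopped_gt:
  fixes a :: "nat \<Rightarrow> real"
  assumes "\<not> (\<Sum>l<m. a l) \<le> 1" "m < n" "\<And>i. 0 \<le> a i"
  shows "1 < (\<Sum>i<n. of_bool ((\<Sum>l<i. a l) \<le> 1) * a i)"
proof -
  define m0 where "m0 = (LEAST m. \<not> (\<Sum>l<m. a l) \<le> 1)"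
  have m0: "\<not> (\<Sum>l<m0. a l) \<le> 1" "m0 \<le> m"
    unfolding m0_def by (rule LeastI, fact, rule Least_le, fact)
  have le: "(\<Sum>l<i. a l) \<le> 1" if "i < m0" for i
    using not_less_Least[of i "\<lambda>m. \<not> (\<Sum>l<m. a l) \<le> 1"] that unfolding m0_def by blast
  have "1 < (\<Sum>l<m0. a l)" using m0 by simp
  also have "\<dots> = (\<Sum>i<m0. of_bool ((\<Sum>l<i. a l) \<le> 1) * a i)"
    by (intro sum.cong) (auto simp: le)
  also have "\<dots> \<le> (\<Sum>i<n. of_bool ((\<Sum>l<i. a l) \<le> 1) * a i)"
    using m0 assms by (intro sum_mono2) auto
  finally show ?thesis .
qed

text \<open>Isolates the factor of highest index in each term, so that the product of the lower ones
  can be averaged over the lower coordinates.\<close>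

lemma prod_telescope:
  fixes u :: "nat \<Rightarrow> real"
  shows "(\<Prod>l<n. 1 + u l) - 1 = (\<Sum>j<n. u j * (\<Prod>l<j. 1 + u l))"
  by (induction n) (auto simp: algebra_simps)

text \<open>
  The factor after the power makes the exponential moments at \<open>\<kappa> = 1, 2, \<dots>\<close> summable to at most 1/2
  of the expected count; the value at 0 is 0.
\<close>

definition young_weight :: "nat \<Rightarrow> real" where
  "young_weight m = ((real m + 1) ^ m - 1) * (exp (- 2 * real m) / (real m * 2 ^ Suc m))"

text \<open>
  The pairs \<open>(kk i, jj i)\<close> list the punctured products, with \<open>kk\<close> descending;
  \<open>nn i\<close> below is \<open>P (kk i) / p (jj i)\<close>. On a fibre \<open>{x + l / P K}\<close>, a product of the cyclic groups
  of order \<open>p l\<close>, \<open>avg (P k)\<close> is the conditional expectation that integrates out the coordinates below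
  \<open>k\<close>, and \<open>periodic (P k)\<close> is measurability with respect to the remaining ones.
\<close>

locale punctured =
  fixes p :: "nat \<Rightarrow> nat" and K M :: nat and kk jj :: "nat \<Rightarrow> nat" and f :: "real \<Rightarrow> real"
  assumes p_pos: "p i > 0"
    and p_coprime: "i \<noteq> i' \<Longrightarrow> coprime (p i) (p i')"
    and jj_less: "i < M \<Longrightarrow> jj i < kk i"
    and kk_le: "i < M \<Longrightarrow> kk i \<le> K"
    and kk_antimono: "i' \<le> i \<Longrightarrow> i < M \<Longrightarrow> kk i \<le> kk i'"
    and f_periodic: "periodic 1 f"
begin

definition P :: "nat \<Rightarrow> nat" where "P k = (\<Prod>l<k. p l)"

definition nn :: "nat \<Rightarrow> nat" where "nn i = (\<Prod>l\<in>{..<kk i} - {jj i}. p l)"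

text \<open>For a fixed puncture these events are disjoint: only the first index in the list, thus
  the one with the longest product, can be hit.\<close>

definition hit :: "nat \<Rightarrow> real \<Rightarrow> bool" where
  "hit i x \<longleftrightarrow> avg (nn i) f x > 1 \<and> (\<forall>i'<i. jj i' = jj i \<longrightarrow> avg (nn i') f x \<le> 1)"

text \<open>The conditional probability of the event given the coordinates from \<open>kk i\<close>
  on.\<close>

definition a :: "nat \<Rightarrow> real \<Rightarrow> real" where
  "a i = avg (P (kk i)) (\<lambda>x. of_bool (hit i x))"

text \<open>
  The \<open>i\<close>-th event is dropped once the accumulated conditional probabilities exceed 1; as each of them
  is at most 1, the kept ones add up to at most 2.
\<close>

definition keep :: "nat \<Rightarrow> real \<Rightarrow> real" where
  "keep i x = of_bool ((\<Sum>l<i. a l x) \<le> 1)"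

definition \<gamma> :: "nat \<Rightarrow> real \<Rightarrow> real" where
  "\<gamma> i x = keep i x * of_bool (hit i x)"

definition \<beta> :: "nat \<Rightarrow> real \<Rightarrow> real" where
  "\<beta> j x = (\<Sum>i\<in>{i. i < M \<and> jj i = j}. \<gamma> i x)"

text \<open>The conditional probability of \<open>\<beta> j = 1\<close> given the coordinates above
  \<open>j\<close>. With coordinates revealed in descending order, this is the increment of the
  compensator of the count.\<close>

definition b :: "nat \<Rightarrow> real \<Rightarrow> real" where
  "b j = avg (P (Suc j)) (\<beta> j)"

definition g :: "real \<Rightarrow> nat" where
  "g x = card {j. j < K \<and> \<beta> j x = 1}"

abbreviation EE :: "(real \<Rightarrow> real) \<Rightarrow> real \<Rightarrow> real" where
  "EE \<equiv> avg (P K)"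

section \<open>Divisibility and measurability of the events\<close>

lemma P_pos: "P k > 0" and nn_pos: "nn i > 0"
  by (simp_all add: P_def nn_def p_pos prod_pos)

lemma P_dvd: "k \<le> k' \<Longrightarrow> P k dvd P k'"
  unfolding P_def by (intro prod_dvd_prod_subset) auto

lemma P_eq_nn: "i < M \<Longrightarrow> P (kk i) = p (jj i) * nn i"
  unfolding P_def nn_def using jj_less by (subst prod.remove[of _ "jj i"]) auto

lemma nn_dvd_P: "i < M \<Longrightarrow> nn i dvd P (kk i)"
  by (simp add: P_eq_nn)

lemma P_dvd_nn: "i < M \<Longrightarrow> P (jj i) dvd nn i"
  unfolding P_def nn_def using jj_less by (intro prod_dvd_prod_subset) fastforce+

lemma nn_dvd_nn: "i' \<le> i \<Longrightarrow> i < M \<Longrightarrow> jj i' = jj i \<Longrightarrow> nn i dvd nn i'"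
  unfolding nn_def using kk_antimono[of i' i] by (intro prod_dvd_prod_subset) auto

lemma coprime_nn: "coprime (p (jj i)) (nn i)"
  unfolding nn_def by (intro prod_coprime_right p_coprime) auto

lemma coprime_P: "coprime (p j) (P j)"
  unfolding P_def by (intro prod_coprime_right p_coprime) auto

lemma periodic_1: "periodic n F \<Longrightarrow> n > 0 \<Longrightarrow> periodic 1 F"
  by (erule periodic_dvd) auto

text \<open>Earlier indices with the same puncture have at least as large a \<open>kk\<close>, so
  the event only involves averages over multiples of \<open>nn i\<close>.\<close>

lemma periodic_hit: "i < M \<Longrightarrow> periodic (nn i) (hit i)"
proof -
  assume i: "i < M"
  have *: "periodic (nn i) (avg (nn i') f)" if "i' \<le> i" "jj i' = jj i" for i'
    using periodic_dvd[OF periodic_avg[OF f_periodic nn_pos, of i'] nn_dvd_nn nn_pos] that i by simp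
  show ?thesis unfolding periodic_def hit_def
    using * by (auto simp: periodic_def)
qed

lemma periodic_hit_real: "i < M \<Longrightarrow> periodic (nn i) (\<lambda>x. of_bool (hit i x) :: real)"
  by (rule periodic_comp[OF periodic_hit])

lemma periodic_a: "i < M \<Longrightarrow> periodic (P (kk i)) (a i)"
  unfolding a_def
  by (intro periodic_avg P_pos periodic_1[OF periodic_hit_real nn_pos])

lemma a_nonneg: "0 \<le> a i x" and a_le_1: "a i x \<le> 1"
proof -
  show "0 \<le> a i x" unfolding a_def by (intro avg_nonneg) auto
  have "a i x \<le> avg (P (kk i)) (\<lambda>_. 1) x" unfolding a_def by (intro avg_mono) auto
  then show "a i x \<le> 1" by (simp add: avg_const P_pos)
qed

text \<open>This is predictability: the decision to keep the event depends on the coordinates from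
  \<open>kk i\<close> on, all revealed before coordinate \<open>jj i\<close>.\<close>

lemma periodic_keep: 
  assumes "i < M" shows "periodic (P (kk i)) (keep i)"
proof -
  have "periodic (P (kk i)) (a l)" if "l < i" for l
    by (rule periodic_dvd[OF periodic_a P_dvd[OF kk_antimono] P_pos]) (use that assms in auto)
  then show ?thesis unfolding periodic_def keep_def by simp
qed

lemma periodic_\<gamma>: 
  assumes "i < M" shows "periodic (nn i) (\<gamma> i)"
proof -
  have "periodic (nn i) (keep i)"
    by (rule periodic_dvd[OF periodic_keep nn_dvd_P P_pos]) (use assms in auto)
  with periodic_hit_real[OF assms] show ?thesis unfolding \<gamma>_def by (rule periodic_comp2[rotated])
qed

lemma periodic_\<beta>: "periodic (P j) (\<beta> j)"
  unfolding \<beta>_def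
  by (intro periodic_sum periodic_dvd[OF periodic_\<gamma> P_dvd_nn nn_pos, THEN subst[of _ _ "\<lambda>j. periodic (P j) _", rotated]]) auto

text \<open>The hits that share a puncture are disjoint, so at most one summand of
  \<open>\<beta> j x\<close> is nonzero.\<close>

lemma \<beta>_cases: "\<beta> j x = 0 \<or> \<beta> j x = 1"
proof (cases "\<exists>i. i < M \<and> jj i = j \<and> hit i x")
  case True
  then obtain i where i: "i < M" "jj i = j" "hit i x" by blast
  have "\<not> hit i' x" if "i' \<noteq> i" "jj i' = j" for i'
    using i that unfolding hit_def by (metis linorder_neqE_nat not_less)
  then have "\<beta> j x = (\<Sum>i'\<in>{i'. i' < M \<and> jj i' = j}. if i' = i then \<gamma> i x else 0)"
    unfolding \<beta>_def by (intro sum.cong) (auto simp: \<gamma>_def)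
  also have "\<dots> = \<gamma> i x" using i by simp
  finally show ?thesis by (auto simp: \<gamma>_def keep_def)
next
  case False
  then have "\<beta> j x = 0" unfolding \<beta>_def \<gamma>_def by (intro sum.neutral) auto
  then show ?thesis by simp
qed

lemma \<beta>_nonneg: "0 \<le> \<beta> j x"
  using \<beta>_cases[of j x] by auto

text \<open>The hit depends only on coordinate \<open>jj i\<close> and on those from
  \<open>kk i\<close> on. Integrating out the coordinates up to \<open>jj i\<close>, or all those
  below \<open>kk i\<close>, therefore gives the same average over \<open>p (jj i)\<close>
  translates.\<close>

lemma avg_\<gamma>:
  assumes "i < M" shows "avg (P (Suc (jj i))) (\<gamma> i) x = keep i x * a i x"
proof -
  have per: "periodic (P (Suc (jj i))) (keep i)"
    by (rule periodic_dvd[OF periodic_keep P_dvd P_pos]) (use assms jj_less in \<open>auto simp: Suc_le_eq\<close>)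
  have h: "periodic (P (jj i)) (\<lambda>x. of_bool (hit i x) :: real)"
    by (rule periodic_dvd[OF periodic_hit_real P_dvd_nn nn_pos]) (use assms in auto)
  note h1 = periodic_1[OF h P_pos]
  have "avg (P (Suc (jj i))) (\<lambda>x. of_bool (hit i x) :: real) x = avg (p (jj i) * P (jj i)) (\<lambda>x. of_bool (hit i x)) x"
    by (simp add: P_def mult.commute)
  also have "\<dots> = avg (p (jj i)) (\<lambda>x. of_bool (hit i x)) x"
    by (rule avg_coprime[OF h1 h coprime_P p_pos P_pos])
  also have "\<dots> = a i x"
    unfolding a_def P_eq_nn[OF assms]
    by (rule avg_coprime[OF h1 periodic_hit_real[OF assms] coprime_nn p_pos nn_pos, symmetric])
  finally show ?thesis unfolding \<gamma>_def by (subst avg_mult_periodic[OF per]) simp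
qed

section \<open>The compensator and exponential moments of the count\<close>

lemma b_eq: "b j x = (\<Sum>i\<in>{i. i < M \<and> jj i = j}. keep i x * a i x)"
  unfolding b_def \<beta>_def avg_sum by (intro sum.cong) (auto simp: avg_\<gamma>[symmetric])

lemma sum_over_jj: "(\<Sum>j<K. \<Sum>i\<in>{i. i < M \<and> jj i = j}. F i) = (\<Sum>i<M. F i)"
proof -
  have "(\<Sum>i<M. F i) = (\<Sum>j<K. \<Sum>i\<in>{i\<in>{..<M}. jj i = j}. F i)"
    by (rule sum.group[symmetric]) (use jj_less kk_le in fastforce)+
  then show ?thesis by simp
qed

lemma sum_b_eq: "(\<Sum>j<K. b j x) = (\<Sum>i<M. keep i x * a i x)"
  unfolding b_eq by (rule sum_over_jj)

lemma b_nonneg: "0 \<le> b j x"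
  unfolding b_eq keep_def by (intro sum_nonneg) (auto simp: a_nonneg)

text \<open>Regrouped by \<open>i\<close>, the compensator is the stopped sum of the
  \<open>a i\<close>; the bound 2 is the level 1 plus one crossing term.\<close>

lemma sum_b_le: "j \<le> K \<Longrightarrow> (\<Sum>l<j. b l x) \<le> 2"
proof -
  assume "j \<le> K"
  then have "(\<Sum>l<j. b l x) \<le> (\<Sum>j<K. b j x)"
    by (intro sum_mono2) (auto simp: b_nonneg)
  also have "\<dots> \<le> 2" unfolding sum_b_eq keep_def
    by (rule sum_stopped_le) (auto simp: a_nonneg a_le_1)
  finally show ?thesis .
qed

lemma periodic_b: "periodic (P (Suc j)) (b j)"
  unfolding b_def by (intro periodic_avg P_pos periodic_1[OF periodic_\<beta> P_pos])

text \<open>The factor of index \<open>j\<close> is constant along the \<open>P j\<close>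
  translates, so the lower factors can be averaged first, to at most 1. Averaging over coordinate
  \<open>j\<close> then leaves \<open>(1 + \<kappa> * b j x) * exp (- \<kappa> * b j x)\<close>,
  which is at most 1.\<close>

lemma supermartingale:
  assumes "\<kappa> \<ge> 0"
  shows "avg (P j) (\<lambda>x. \<Prod>l<j. (1 + \<kappa> * \<beta> l x) * exp (- \<kappa> * b l x)) x \<le> 1"
proof (induction j arbitrary: x)
  case 0
  then show ?case by (simp add: avg_const P_pos)
next
  case (Suc j)
  define X where "X = (\<lambda>x. \<Prod>l<j. (1 + \<kappa> * \<beta> l x) * exp (- \<kappa> * b l x))"
  define Y where "Y = (\<lambda>x. (1 + \<kappa> * \<beta> j x) * exp (- \<kappa> * b j x))"
  have perb: "periodic (P j) (b j)"
    by (rule periodic_dvd[OF periodic_b P_dvd P_pos]) auto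
  have perY: "periodic (P j) Y" unfolding Y_def
    using perb periodic_\<beta>[of j] by (simp add: periodic_def)
  have perX1: "periodic 1 (\<lambda>x. Y x * X x)"
  proof -
    have "periodic 1 (b l)" "periodic 1 (\<beta> l)" for l
      using periodic_1[OF periodic_b P_pos] periodic_1[OF periodic_\<beta> P_pos] by auto
    then show ?thesis unfolding X_def Y_def by (simp add: periodic_def)
  qed
  have Ynn: "0 \<le> Y x" for x unfolding Y_def using assms \<beta>_nonneg[of j x] by simp
  have "avg (P (Suc j)) (\<lambda>x. Y x * X x) x = avg (P (Suc j)) (avg (P j) (\<lambda>x. Y x * X x)) x"
    by (rule avg_avg_dvd[symmetric, OF perX1 P_dvd P_pos]) auto
  also have "\<dots> \<le> avg (P (Suc j)) Y x"
  proof (rule avg_mono)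
    fix x
    have "avg (P j) (\<lambda>x. Y x * X x) x = Y x * avg (P j) X x"
      by (rule avg_mult_periodic[OF perY])
    also have "\<dots> \<le> Y x * 1"
      using Suc.IH[of x] Ynn by (intro mult_left_mono) (auto simp: X_def)
    finally show "avg (P j) (\<lambda>x. Y x * X x) x \<le> Y x" by simp
  qed
  also have "\<dots> = exp (- \<kappa> * b j x) * avg (P (Suc j)) (\<lambda>x. 1 + \<kappa> * \<beta> j x) x"
  proof -
    have "periodic (P (Suc j)) (\<lambda>x. exp (- \<kappa> * b j x))"
      using periodic_b by (rule periodic_comp)
    from avg_mult_periodic[OF this, of "\<lambda>x. 1 + \<kappa> * \<beta> j x" x] show ?thesis
      unfolding Y_def by (simp add: mult.commute)
  qed
  also have "avg (P (Suc j)) (\<lambda>x. 1 + \<kappa> * \<beta> j x) x = 1 + \<kappa> * b j x"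
    unfolding b_def by (simp add: avg_add avg_cmult avg_const P_pos)
  also have "exp (- \<kappa> * b j x) * (1 + \<kappa> * b j x) \<le> exp (- \<kappa> * b j x) * exp (\<kappa> * b j x)"
    using exp_ge_add_one_self[of "\<kappa> * b j x"] by (intro mult_left_mono) auto
  also have "\<dots> = 1" by (simp add: exp_minus)
  finally show ?case unfolding X_def Y_def by (simp add: mult.commute)
qed

text \<open>As the compensator is at most 2, removing the exponential factors of the supermartingale
  costs at most \<open>exp (2 * \<kappa>)\<close>.\<close>

lemma avg_prod_le:
  assumes "\<kappa> \<ge> 0" "j \<le> K"
  shows "avg (P j) (\<lambda>x. \<Prod>l<j. 1 + \<kappa> * \<beta> l x) x \<le> exp (2 * \<kappa>)"
proof -
  have "(\<Prod>l<j. 1 + \<kappa> * \<beta> l x) \<le> exp (2 * \<kappa>) * (\<Prod>l<j. (1 + \<kappa> * \<beta> l x) * exp (- \<kappa> * b l x))" for x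
  proof -
    have "1 \<le> exp (2 * \<kappa> - \<kappa> * (\<Sum>l<j. b l x))"
      using mult_left_mono[OF sum_b_le[OF assms(2), of x] assms(1)] by simp
    also have "\<dots> = exp (2 * \<kappa>) * (\<Prod>l<j. exp (- \<kappa> * b l x))"
      by (simp add: exp_sum[symmetric] exp_add[symmetric] sum_negf sum_distrib_left)
    finally have "(\<Prod>l<j. 1 + \<kappa> * \<beta> l x) * 1 \<le> (\<Prod>l<j. 1 + \<kappa> * \<beta> l x) * (exp (2 * \<kappa>) * (\<Prod>l<j. exp (- \<kappa> * b l x)))"
      using assms \<beta>_nonneg by (intro mult_left_mono prod_nonneg) auto
    then show ?thesis by (simp add: prod.distrib mult_ac)
  qed
  then have "avg (P j) (\<lambda>x. \<Prod>l<j. 1 + \<kappa> * \<beta> l x) x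
     \<le> exp (2 * \<kappa>) * avg (P j) (\<lambda>x. \<Prod>l<j. (1 + \<kappa> * \<beta> l x) * exp (- \<kappa> * b l x)) x"
    unfolding avg_cmult[symmetric] by (rule avg_mono)
  also have "\<dots> \<le> exp (2 * \<kappa>) * 1"
    using supermartingale[OF assms(1)] by (intro mult_left_mono) auto
  finally show ?thesis by simp
qed

lemma g_eq: "real (g x) = (\<Sum>j<K. \<beta> j x)"
proof -
  have "(\<Sum>j<K. \<beta> j x) = (\<Sum>j<K. if \<beta> j x = 1 then 1 else 0)"
    using \<beta>_cases[of _ x] by (intro sum.cong refl) (metis (full_types))
  also have "\<dots> = real (g x)" unfolding g_def by (simp add: sum.If_cases Int_def)
  finally show ?thesis by simp
qed

lemma g_eq': "real (g x) = (\<Sum>i<M. \<gamma> i x)"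
  unfolding g_eq \<beta>_def by (rule sum_over_jj)

lemma g_le: "g x \<le> K"
  unfolding g_def by (rule order_trans[OF card_mono[of "{..<K}"]]) auto

lemma prod_eq_power: "(\<Prod>l<K. 1 + \<kappa> * \<beta> l x) = (1 + \<kappa>) ^ g x"
proof -
  have "(\<Prod>l<K. 1 + \<kappa> * \<beta> l x) = (\<Prod>l<K. if \<beta> l x = 1 then 1 + \<kappa> else 1)"
    using \<beta>_cases[of _ x]
    by (intro prod.cong refl) (metis (full_types) add.right_neutral mult_zero_right mult.right_neutral)
  also have "\<dots> = (1 + \<kappa>) ^ g x"
    unfolding g_def by (simp add: prod.If_cases Int_def)
  finally show ?thesis .
qed

text \<open>In each term of the telescoped product, conditioning on the coordinates from
  \<open>j\<close> on leaves \<open>\<beta> j\<close> untouched and bounds the product over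
  \<open>l < j\<close> by \<open>exp (2 * \<kappa>)\<close>.\<close>

lemma exponential_moment:
  assumes "\<kappa> \<ge> 0"
  shows "EE (\<lambda>x. (1 + \<kappa>) ^ g x - 1) x \<le> \<kappa> * exp (2 * \<kappa>) * EE (\<lambda>x. real (g x)) x"
proof -
  have "EE (\<lambda>x. (1 + \<kappa>) ^ g x - 1) x = (\<Sum>j<K. EE (\<lambda>x. \<kappa> * \<beta> j x * (\<Prod>l<j. 1 + \<kappa> * \<beta> l x)) x)"
    unfolding prod_eq_power[symmetric] prod_telescope by (rule avg_sum)
  also have "\<dots> \<le> (\<Sum>j<K. EE (\<lambda>x. \<kappa> * \<beta> j x * exp (2 * \<kappa>)) x)"
  proof (rule sum_mono)
    fix j assume j: "j \<in> {..<K}"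
    let ?X = "\<lambda>x. \<Prod>l<j. 1 + \<kappa> * \<beta> l x"
    have p1: "periodic 1 (\<lambda>x. (\<kappa> * \<beta> j x) * ?X x)"
      using periodic_1[OF periodic_\<beta> P_pos] by (simp add: periodic_def)
    have "EE (\<lambda>x. (\<kappa> * \<beta> j x) * ?X x) x = EE (avg (P j) (\<lambda>x. (\<kappa> * \<beta> j x) * ?X x)) x"
      by (rule avg_avg_dvd[symmetric, OF p1 P_dvd P_pos]) (use j in auto)
    also have "avg (P j) (\<lambda>x. (\<kappa> * \<beta> j x) * ?X x) = (\<lambda>x. (\<kappa> * \<beta> j x) * avg (P j) ?X x)"
      by (intro ext avg_mult_periodic periodic_comp[OF periodic_\<beta>])
    also have "EE (\<lambda>x. (\<kappa> * \<beta> j x) * avg (P j) ?X x) x \<le> EE (\<lambda>x. \<kappa> * \<beta> j x * exp (2 * \<kappa>)) x"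
      using avg_prod_le[OF assms] j assms \<beta>_nonneg by (intro avg_mono mult_left_mono) auto
    finally show "EE (\<lambda>x. \<kappa> * \<beta> j x * ?X x) x \<le> EE (\<lambda>x. \<kappa> * \<beta> j x * exp (2 * \<kappa>)) x" .
  qed
  also have "\<dots> = EE (\<lambda>x. \<Sum>j<K. (\<kappa> * exp (2 * \<kappa>)) * \<beta> j x) x"
    by (simp add: avg_sum mult_ac)
  also have "\<dots> = EE (\<lambda>x. (\<kappa> * exp (2 * \<kappa>)) * real (g x)) x"
    by (simp add: g_eq sum_distrib_left)
  finally show ?thesis by (simp add: avg_cmult)
qed

text \<open>On each kept event the mean over \<open>nn i\<close> translates exceeds 1. The event has
  period \<open>1 / nn i\<close>, so the tower property replaces that mean by \<open>f\<close>
  itself.\<close>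

lemma E_g_le: "EE (\<lambda>x. real (g x)) x \<le> EE (\<lambda>x. f x * real (g x)) x"
proof -
  have "EE (\<gamma> i) x \<le> EE (\<lambda>x. \<gamma> i x * f x) x" if i: "i < M" for i
  proof -
    have per: "periodic 1 (\<lambda>x. \<gamma> i x * f x)"
      using periodic_1[OF periodic_\<gamma>[OF i] nn_pos] f_periodic by (rule periodic_comp2)
    have "EE (\<gamma> i) x \<le> EE (\<lambda>x. \<gamma> i x * avg (nn i) f x) x"
      by (rule avg_mono) (auto simp: \<gamma>_def keep_def hit_def)
    also have "(\<lambda>x. \<gamma> i x * avg (nn i) f x) = avg (nn i) (\<lambda>x. \<gamma> i x * f x)"
      by (intro ext avg_mult_periodic[symmetric] periodic_\<gamma> i)
    also have "EE \<dots> x = EE (\<lambda>x. \<gamma> i x * f x) x"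
      by (rule avg_avg_dvd[OF per _ P_pos]) (use nn_dvd_P P_dvd kk_le i dvd_trans in blast)
    finally show ?thesis .
  qed
  then have "(\<Sum>i<M. EE (\<gamma> i) x) \<le> (\<Sum>i<M. EE (\<lambda>x. \<gamma> i x * f x) x)"
    by (intro sum_mono) auto
  then show ?thesis
    by (simp add: g_eq' avg_sum[symmetric] sum_distrib_right mult.commute[of "f _"])
qed

text \<open>The weight of \<open>g x\<close> is the single term \<open>r = g x\<close> of a sum over
  \<open>r\<close> of multiples of \<open>(1 + r) ^ g x - 1\<close>. The coefficients are chosen so
  that the \<open>r\<close>-th exponential moment contributes at most \<open>(1/2) ^ Suc r\<close>
  times the expected count.\<close>

lemma E_weight_le: "EE (\<lambda>x. young_weight (g x)) x \<le> EE (\<lambda>x. real (g x)) x / 2"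
proof -
  define c where "c r = exp (- 2 * real r) / (real r * 2 ^ Suc r)" for r :: nat
  have "young_weight (g x) \<le> (\<Sum>r\<in>{1..K}. c r * ((1 + real r) ^ g x - 1))" for x
  proof (cases "g x = 0")
    case False
    have "c (g x) * ((1 + real (g x)) ^ g x - 1) \<le> (\<Sum>r\<in>{1..K}. c r * ((1 + real r) ^ g x - 1))"
      by (rule member_le_sum[of "g x"]) (use False g_le[of x] in \<open>auto simp: c_def intro!: mult_nonneg_nonneg\<close>)
    then show ?thesis by (simp add: young_weight_def c_def mult.commute add.commute)
  qed (simp add: young_weight_def)
  then have "EE (\<lambda>x. young_weight (g x)) x \<le> EE (\<lambda>x. \<Sum>r\<in>{1..K}. c r * ((1 + real r) ^ g x - 1)) x"
    by (rule avg_mono)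
  also have "\<dots> = (\<Sum>r\<in>{1..K}. c r * EE (\<lambda>x. (1 + real r) ^ g x - 1) x)"
    by (simp add: avg_sum avg_cmult)
  also have "\<dots> \<le> (\<Sum>r\<in>{1..K}. (1/2) ^ Suc r * EE (\<lambda>x. real (g x)) x)"
  proof (rule sum_mono)
    fix r assume r: "r \<in> {1..K}"
    have "c r * EE (\<lambda>x. (1 + real r) ^ g x - 1) x 
       \<le> c r * (real r * exp (2 * real r) * EE (\<lambda>x. real (g x)) x)"
      using exponential_moment[of "real r" x] by (intro mult_left_mono) (auto simp: c_def)
    also have "\<dots> = (1/2) ^ Suc r * EE (\<lambda>x. real (g x)) x"
      using r by (simp add: c_def exp_minus field_simps)
    finally show "c r * EE (\<lambda>x. (1 + real r) ^ g x - 1) x \<le> (1/2) ^ Suc r * EE (\<lambda>x. real (g x)) x" .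
  qed
  also have "\<dots> = (\<Sum>r\<in>{1..K}. (1/2) ^ Suc r) * EE (\<lambda>x. real (g x)) x"
    by (simp only: sum_distrib_right)
  also have "\<dots> \<le> (1/2) * EE (\<lambda>x. real (g x)) x"
  proof (rule mult_right_mono)
    have "(\<Sum>r\<in>{1..n}. (1/2::real) ^ Suc r) = 1/2 - (1/2) ^ Suc n" for n
      by (induction n) auto
    then show "(\<Sum>r\<in>{1..K}. (1/2::real) ^ Suc r) \<le> 1/2" by simp
  qed (simp add: avg_nonneg)
  finally show ?thesis by simp
qed

text \<open>The weight costs only half of the expected count, which is absorbed on the left.\<close>

lemma E_g_upper:
  assumes "\<And>x m. f x * real m \<le> \<phi> x + young_weight m"
  shows "EE (\<lambda>x. real (g x)) x \<le> 2 * EE \<phi> x"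
proof -
  have "EE (\<lambda>x. real (g x)) x \<le> EE (\<lambda>x. f x * real (g x)) x" by (rule E_g_le)
  also have "\<dots> \<le> EE (\<lambda>x. \<phi> x + young_weight (g x)) x" using assms by (intro avg_mono)
  also have "\<dots> \<le> EE \<phi> x + EE (\<lambda>x. real (g x)) x / 2"
    using E_weight_le[of x] by (simp add: avg_add)
  finally show ?thesis by simp
qed

lemma E_b_eq: "EE (\<lambda>x. \<Sum>j<K. b j x) x = EE (\<lambda>x. real (g x)) x"
proof -
  have "EE (b j) x = EE (\<beta> j) x" if "j < K" for j
    unfolding b_def
    by (rule avg_avg_dvd[OF periodic_1[OF periodic_\<beta> P_pos] P_dvd P_pos]) (use that in auto)
  then show ?thesis by (simp add: avg_sum g_eq)
qed

text \<open>Take the first index with the given puncture whose mean exceeds 1. If its event is kept,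
  \<open>g\<close> counts it; if it is dropped, the accumulated probabilities have passed 1, and so
  has the compensator. Both quantities have the same expectation.\<close>

lemma maximal_inequality_pointwise:
  assumes "\<And>x m. f x * real m \<le> \<phi> x + young_weight m"
  shows "EE (\<lambda>x. of_bool (\<exists>i<M. avg (nn i) f x > 1)) x \<le> 4 * EE \<phi> x"
proof -
  have "of_bool (\<exists>i<M. avg (nn i) f x > 1) \<le> real (g x) + (\<Sum>j<K. b j x)" for x
  proof (cases "\<exists>i<M. avg (nn i) f x > 1")
    case True
    then obtain i0 where i0: "i0 < M" "avg (nn i0) f x > 1" by blast
    define Q where "Q i \<longleftrightarrow> jj i = jj i0 \<and> avg (nn i) f x > 1" for i
    define i where "i = (LEAST i. Q i)"
    have Q: "Q i" unfolding i_def by (rule LeastI[of _ i0]) (use i0 in \<open>simp add: Q_def\<close>)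
    have "i \<le> i0" unfolding i_def by (rule Least_le) (use i0 in \<open>simp add: Q_def\<close>)
    with i0 have i: "i < M" by simp
    have hit: "hit i x" unfolding hit_def
      using Q not_less_Least[of _ Q] unfolding i_def[symmetric] by (auto simp: Q_def not_less)
    have nonneg: "0 \<le> (\<Sum>j<K. b j x)" by (intro sum_nonneg b_nonneg)
    show ?thesis
    proof (cases "(\<Sum>l<i. a l x) \<le> 1")
      case True
      then have "1 = \<gamma> i x" using hit by (simp add: \<gamma>_def keep_def)
      also have "\<dots> \<le> (\<Sum>i<M. \<gamma> i x)"
        by (rule member_le_sum) (use i in \<open>auto simp: \<gamma>_def keep_def\<close>)
      finally have "1 \<le> real (g x)" by (simp add: g_eq')
      then show ?thesis using nonneg by (simp split: split_of_bool)
    next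
      case False
      then have "1 < (\<Sum>j<K. b j x)"
        unfolding sum_b_eq keep_def by (rule sum_stopped_gt[OF _ i a_nonneg])
      then show ?thesis by (simp split: split_of_bool)
    qed
  next
    case False
    then show ?thesis using sum_nonneg[of "{..<K}" "\<lambda>j. b j x"] b_nonneg
      by (auto split: split_of_bool)
  qed
  then have "EE (\<lambda>x. of_bool (\<exists>i<M. avg (nn i) f x > 1)) x \<le> EE (\<lambda>x. real (g x) + (\<Sum>j<K. b j x)) x"
    by (rule avg_mono)
  also have "\<dots> = 2 * EE (\<lambda>x. real (g x)) x" by (simp add: avg_add E_b_eq)
  also have "\<dots> \<le> 4 * EE \<phi> x" using E_g_upper[OF assms, of x] by simp
  finally show ?thesis .
qed

end

subsection \<open>The function \<open>Phi\<close> and a Young-type inequality\<close>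

lemma of_nat_power_le_succ_power: "m \<ge> 1 \<Longrightarrow> real m ^ m \<le> (real m + 1) ^ m - 1"
proof -
  assume m: "m \<ge> 1"
  have "m ^ m < Suc m ^ m" using m by (intro power_strict_mono) auto
  then have "real (m ^ m + 1) \<le> real (Suc m ^ m)" by (simp only: of_nat_le_iff Suc_eq_plus1[symmetric] Suc_le_eq)
  then show ?thesis by (simp add: add.commute)
qed

text \<open>The bound \<open>m * 2 ^ Suc m \<le> 4 ^ m\<close> turns the weight into a pure
  \<open>m\<close>-th power, convenient for taking logarithms.\<close>

lemma young_weight_ge:
  assumes "m \<ge> 1" shows "(real m / (4 * exp 2)) ^ m \<le> young_weight m"
proof -
  have "2 * k \<le> 2 ^ k" if "k \<ge> 1" for k :: nat using that
    by (induction k rule: dec_induct) auto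
  then have "2 * m \<le> 2 ^ m" using assms by simp
  then have "m * 2 ^ Suc m \<le> 2 ^ m * 2 ^ m" by simp
  also have "\<dots> = 4 ^ m" by (simp flip: power_mult_distrib)
  finally have "real (m * 2 ^ Suc m) \<le> real (4 ^ m)" by (simp only: of_nat_le_iff)
  then have 1: "real m * 2 ^ Suc m \<le> 4 ^ m" by simp
  have "(real m / (4 * exp 2)) ^ m = real m ^ m * (exp (- 2 * real m) / 4 ^ m)"
    by (simp add: power_divide power_mult_distrib exp_minus exp_of_nat_mult[symmetric] mult.commute field_simps)
  also have "\<dots> \<le> ((real m + 1) ^ m - 1) * (exp (- 2 * real m) / (real m * 2 ^ Suc m))"
    using assms 1 of_nat_power_le_succ_power[OF assms]
    by (intro mult_mono divide_left_mono mult_pos_pos) auto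
  finally show ?thesis by (simp add: young_weight_def)
qed


section \<open>Growth and monotonicity of \<open>Phi\<close>\<close>

lemma one_less_ln_3: "1 < ln (3::real)"
proof -
  \<comment> \<open>Since \<open>(5/6) ^ 6 > 1/3\<close>, the tangent bound for \<open>exp\<close>
    at \<open>-1/6\<close> is sharp enough to give \<open>exp 1 < 3\<close>.\<close>
  have "(5/6::real) ^ 6 \<le> exp (-1/6) ^ 6"
    using exp_ge_add_one_self[of "-1/6"] by (intro power_mono) auto
  also have "\<dots> = exp (-1)" by (simp flip: exp_of_nat_mult)
  finally have "exp 1 < (3::real)" by (simp add: exp_minus field_simps)
  then have "ln (exp 1) < ln (3::real)" by (subst ln_less_cancel_iff) auto
  then show ?thesis by simp
qed

lemma one_less_ln_3_plus: "0 \<le> x \<Longrightarrow> 1 < ln (3 + x :: real)"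
  using one_less_ln_3 ln_mono[of 3 "3 + x"] by linarith

lemma lnln_pos: "0 \<le> x \<Longrightarrow> 0 < ln (ln (3 + x :: real))"
  using one_less_ln_3_plus by simp

lemma lnln_mono: "0 \<le> x \<Longrightarrow> x \<le> y \<Longrightarrow> ln (ln (3 + x)) \<le> ln (ln (3 + y :: real))"
  using one_less_ln_3_plus[of x] by (intro ln_mono) auto

lemma Phi_nonneg: "0 \<le> x \<Longrightarrow> 0 \<le> Phi x"
  unfolding Phi_def using lnln_pos[of x] by simp

lemma Phi_0 [simp]: "Phi 0 = 0"
  by (simp add: Phi_def)

lemma Phi_le_square: "0 \<le> x \<Longrightarrow> Phi x \<le> x\<^sup>2 / ln (ln 3)"
  unfolding Phi_def power2_eq_square using lnln_mono[of 0 x] lnln_pos[of 0]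
  by (intro frac_le mult_left_mono ln_add_one_self_le_self) auto

lemma ln_1_plus_mult_le:
  assumes "1 \<le> c" "0 \<le> x" shows "ln (1 + c * x) \<le> c * ln (1 + x :: real)"
proof -
  let ?h = "\<lambda>x. c * ln (1 + x) - ln (1 + c * x)"
  have "?h 0 \<le> ?h x"
  proof (rule DERIV_nonneg_imp_nondecreasing[OF assms(2)])
    fix t :: real assume t: "0 \<le> t" "t \<le> x"
    have ct: "1 + t \<le> 1 + c * t" using t assms mult_right_mono[of 1 c t] by simp
    have "(?h has_real_derivative (c / (1 + t) - c / (1 + c * t))) (at t)"
      using t ct by (auto intro!: derivative_eq_intros)
    moreover have "0 \<le> c / (1 + t) - c / (1 + c * t)"
      using ct t assms by (simp add: frac_le)
    ultimately show "\<exists>y. (?h has_real_derivative y) (at t) \<and> 0 \<le> y" by blast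
  qed
  then show ?thesis by simp
qed

text \<open>A doubling condition: scaling the argument preserves integrability of
  \<open>Phi\<close>, because \<open>ln (1 + c * x)\<close> is at most
  \<open>c * ln (1 + x)\<close>.\<close>

lemma Phi_mult_le:
  assumes "1 \<le> c" "0 \<le> x" shows "Phi (c * x) \<le> c\<^sup>2 * Phi x"
proof -
  have "x \<le> c * x" using assms mult_right_mono[of 1 c x] by simp
  then have "Phi (c * x) \<le> (c * x) * (c * ln (1 + x)) / ln (ln (3 + x))"
    unfolding Phi_def using assms ln_1_plus_mult_le[of c x] lnln_mono[of x "c * x"] lnln_pos[of x]
    by (intro frac_le mult_left_mono) auto
  then show ?thesis by (simp add: Phi_def power2_eq_square mult_ac)
qed

text \<open>Already \<open>x / ln (ln (3 + x))\<close> is nondecreasing. With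
  \<open>w = ln (3 + t)\<close>, the sign of its derivative reduces to
  \<open>t / (3 + t) / w \<le> ln w\<close>, which follows from \<open>ln y \<le> y - 1\<close> used
  twice and \<open>ln 3 > 1\<close>.\<close>

lemma Phi_mono:
  assumes "0 \<le> x" "x \<le> y" shows "Phi x \<le> Phi y"
proof -
  let ?h = "\<lambda>x. x / ln (ln (3 + x :: real))"
  have "?h x \<le> ?h y"
  proof (rule DERIV_nonneg_imp_nondecreasing[OF assms(2)])
    fix t assume "x \<le> t" "t \<le> y"
    then have t: "0 \<le> t" using assms by simp
    define w where "w = ln (3 + t)"
    have w: "1 < w" unfolding w_def using t by (rule one_less_ln_3_plus)
    have "ln (3 / (3 + t)) \<le> 3 / (3 + t) - 1" using t by (intro ln_le_minus_one) auto
    also have "\<dots> = - (t / (3 + t))" using t by (simp add: field_simps)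
    finally have "t / (3 + t) \<le> w - ln 3" using t by (simp add: w_def ln_div)
    then have "t / (3 + t) \<le> w - 1" using one_less_ln_3 by simp
    then have "t / (3 + t) / w \<le> (w - 1) / w" using w by (intro divide_right_mono) auto
    also have "\<dots> = 1 - 1 / w" using w by (simp add: field_simps)
    also have "\<dots> \<le> ln w" using ln_le_minus_one[of "1 / w"] w by (simp add: ln_div)
    finally have le: "t / (3 + t) / w \<le> ln w" .
    have lw: "0 < ln w" using w by simp
    have "(?h has_real_derivative ((ln w - t / (3 + t) / w) / (ln w)\<^sup>2)) (at t)"
      using t w lw unfolding w_def
      by (auto intro!: derivative_eq_intros simp: power2_eq_square field_simps)
    then show "\<exists>d. (?h has_real_derivative d) (at t) \<and> 0 \<le> d"
      using le by (intro exI[of _ "(ln w - t / (3 + t) / w) / (ln w)\<^sup>2"]) auto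
  qed
  moreover have "0 \<le> ?h x" using assms lnln_pos[of x] by simp
  ultimately have "?h x * ln (1 + x) \<le> ?h y * ln (1 + y)"
    using assms by (intro mult_mono) auto
  then show ?thesis by (simp add: Phi_def)
qed

section \<open>Young's inequality above the threshold\<close>

lemma ln_le_sqrt: "0 < x \<Longrightarrow> ln x \<le> sqrt x" for x :: real
proof -
  assume x: "0 < x"
  \<comment> \<open>Passing to the fourth root \<open>y\<close> gives
    \<open>ln x \<le> 4 * y - 4\<close>, and \<open>(y - 2)\<^sup>2 \<ge> 0\<close> bounds this by
    the square of \<open>y\<close>.\<close>
  then have "ln (sqrt (sqrt x)) \<le> sqrt (sqrt x) - 1" by (intro ln_le_minus_one) auto
  then have *: "ln x \<le> 4 * sqrt (sqrt x) - 4" using x by (simp add: ln_sqrt)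
  have "0 \<le> (sqrt (sqrt x) - 2)\<^sup>2" by simp
  also have "(sqrt (sqrt x) - 2)\<^sup>2 = sqrt x - 4 * sqrt (sqrt x) + 4"
    using x by (simp add: power2_diff)
  finally show ?thesis using * by simp
qed

text \<open>In logarithms it suffices that \<open>l + m \<le> m * L\<close>. The threshold gives
  \<open>m * ln l \<ge> 2 * l\<close>, and its consequence \<open>m \<ge> D * sqrt l\<close> gives
  \<open>L \<ge> 2 + ln l / 2\<close>.\<close>

lemma young_inequality:
  fixes D :: real
  defines "D \<equiv> 4 * exp 2 * exp 2"
  assumes z: "1 \<le> z" and m: "m \<ge> 1"
    and large: "real m > 2 * D * ln (1 + z) / ln (ln (3 + z))"
  shows "z * real m \<le> young_weight m"
proof -
  define l where "l = ln (3 + z)"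
  define L where "L = ln (real m / (4 * exp 2))"
  have z3: "0 < 3 + z" using z by simp
  have l1: "1 < l" unfolding l_def using z by (intro one_less_ln_3_plus) auto
  have D: "D \<ge> 4" unfolding D_def using one_le_exp_iff[of 2] mult_mono[of 1 "exp 2" 1 "exp 2 :: real"] by simp
  \<comment> \<open>Here \<open>z \<ge> 1\<close> enters; comparing \<open>ln (3 + z)\<close> with
    \<open>ln (1 + z)\<close> uses up the factor 2 of the threshold.\<close>
  have "3 + z \<le> (1 + z)\<^sup>2" using z mult_mono[of 1 z 1 z] by (simp add: power2_eq_square algebra_simps)
  then have "l \<le> ln ((1 + z)\<^sup>2)" unfolding l_def using z by (intro ln_mono) auto
  then have "l \<le> 2 * ln (1 + z)" using z by (simp add: ln_realpow)
  then have "D * l \<le> D * (2 * ln (1 + z))" using D by (intro mult_left_mono) auto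
  then have "D * l / ln l \<le> 2 * D * ln (1 + z) / ln l"
    using l1 by (intro divide_right_mono) auto
  then have m1: "D * l / ln l < real m" using large by (simp add: l_def)
  have "sqrt l * ln l \<le> sqrt l * sqrt l" using ln_le_sqrt[of l] l1 by (intro mult_left_mono) auto
  then have "sqrt l \<le> l / ln l" using l1 by (simp add: field_simps)
  then have "D * sqrt l \<le> D * (l / ln l)" using D by (intro mult_left_mono) auto
  then have m2: "D * sqrt l \<le> real m" using m1 by simp
  \<comment> \<open>In \<open>D\<close>, the factor \<open>4 * exp 2\<close> cancels the denominator
    inside \<open>L\<close>, and the other \<open>exp 2\<close> becomes the summand 2 in the lower
    bound of \<open>L\<close>.\<close>
  have "exp 2 * sqrt l \<le> real m / (4 * exp 2)"
    using m2 by (simp add: D_def field_simps)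
  then have "ln (exp 2 * sqrt l) \<le> L" unfolding L_def using l1 by (intro ln_mono) auto
  then have L: "2 + ln l / 2 \<le> L" using l1 by (simp add: ln_mult ln_sqrt)
  have "l + real m \<le> real m * L"
  proof -
    have "l \<le> real m * (ln l / 2)"
    proof -
      have "D * l \<le> real m * ln l" using m1 l1 by (simp add: field_simps)
      moreover have "2 * l \<le> D * l" using D l1 by (intro mult_right_mono) auto
      ultimately show ?thesis by simp
    qed
    also have "real m * (ln l / 2) + real m \<le> real m * L"
      using mult_left_mono[OF L, of "real m"] m by (simp add: algebra_simps)
    finally show ?thesis by simp
  qed
  moreover have "ln (z * real m) \<le> l + real m"
  proof -
    have "ln z \<le> l" unfolding l_def using z by (intro ln_mono) auto
    moreover have "ln (real m) \<le> real m" using m by (intro less_imp_le ln_less_self) auto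
    ultimately show ?thesis using z m by (simp add: ln_mult)
  qed
  ultimately have "ln (z * real m) \<le> ln ((real m / (4 * exp 2)) ^ m)"
    unfolding L_def using m by (subst ln_realpow) auto
  then have "z * real m \<le> (real m / (4 * exp 2)) ^ m"
    using z m by (subst (asm) ln_le_cancel_iff) auto
  also have "\<dots> \<le> young_weight m" by (rule young_weight_ge[OF m])
  finally show ?thesis .
qed

subsection \<open>Punctured primorials\<close>

definition prime_at :: "nat \<Rightarrow> nat" where
  "prime_at = enumerate {p. prime p}"

definition primorial :: "nat \<Rightarrow> nat" where
  "primorial K = (\<Prod>l<K. prime_at l)"

definition punctured_primorial :: "nat \<Rightarrow> nat \<Rightarrow> nat" where
  "punctured_primorial k j = (\<Prod>l\<in>{..<k} - {j}. prime_at l)"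

text \<open>A finite stage consisting of divisors of \<open>primorial K\<close>, so that it can be
  handled on a single fibre. Primes and punctures are numbered from 0.\<close>

definition punctured_primorials_upto :: "nat \<Rightarrow> nat set" where
  "punctured_primorials_upto K = {punctured_primorial k j | k j. 2 \<le> k \<and> k \<le> K \<and> j < k}"

lemma prime_prime_at: "prime (prime_at l)"
  using enumerate_in_set[of "{p::nat. prime p}" l] primes_infinite by (simp add: prime_at_def)

lemma prime_at_inject: "prime_at l = prime_at l' \<longleftrightarrow> l = l'"
  using strict_mono_enumerate[of "{p::nat. prime p}"] primes_infinite
  by (simp add: prime_at_def strict_mono_eq)

lemma prime_at_pos: "prime_at l > 0"
  using prime_prime_at prime_gt_0_nat by blast

lemma primorial_pos: "primorial K > 0"
  by (simp add: primorial_def prime_at_pos prod_pos)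

lemma punctured_primorial_pos: "punctured_primorial k j > 0"
  by (simp add: punctured_primorial_def prime_at_pos prod_pos)

lemma finite_punctured_primorials_upto: "finite (punctured_primorials_upto K)"
proof -
  have "punctured_primorials_upto K \<subseteq> (\<lambda>(k, j). punctured_primorial k j) ` ({..K} \<times> {..<K})"
    unfolding punctured_primorials_upto_def by force
  then show ?thesis by (rule finite_subset) auto
qed

lemma punctured_primorials_upto_mono: "K \<le> K' \<Longrightarrow> punctured_primorials_upto K \<subseteq> punctured_primorials_upto K'"
  unfolding punctured_primorials_upto_def by (blast intro: order_trans)

lemma punctured_primorials_eq: "punctured_primorials = (\<Union>K. punctured_primorials_upto K)"
proof -
  \<comment> \<open>The shift by \<open>Suc\<close> passes between the numbering of the primes from
    1 and that from 0.\<close>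
  have eq: "(\<Prod>i\<in>{i. 1 \<le> i \<and> i \<le> k \<and> i \<noteq> Suc j}. nth_prime i) = punctured_primorial k j" for k j
    unfolding punctured_primorial_def nth_prime_def prime_at_def
    by (rule prod.reindex_bij_witness[of _ Suc "\<lambda>i. i - 1"]) auto
  show ?thesis
  proof (intro equalityI subsetI)
    fix n assume "n \<in> punctured_primorials"
    then obtain k j where kj: "2 \<le> k" "1 \<le> j" "j \<le> k"
      "n = (\<Prod>i\<in>{i. 1 \<le> i \<and> i \<le> k \<and> i \<noteq> j}. nth_prime i)"
      unfolding punctured_primorials_def by blast
    then have "n = punctured_primorial k (j - 1)" using eq[of k "j - 1"] by simp
    moreover have "j - 1 < k" using kj by simp
    ultimately show "n \<in> (\<Union>K. punctured_primorials_upto K)"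
      using kj(1) unfolding punctured_primorials_upto_def by blast
  next
    fix n assume "n \<in> (\<Union>K. punctured_primorials_upto K)"
    then obtain k j where kj: "2 \<le> k" "j < k" "n = punctured_primorial k j"
      unfolding punctured_primorials_upto_def by blast
    then have "n = (\<Prod>i\<in>{i. 1 \<le> i \<and> i \<le> k \<and> i \<noteq> Suc j}. nth_prime i)" by (simp only: eq)
    moreover have "1 \<le> Suc j" "Suc j \<le> k" using kj by auto
    ultimately show "n \<in> punctured_primorials"
      using kj(1) unfolding punctured_primorials_def by blast
  qed
qed

text \<open>The pairs \<open>(k, j)\<close> are listed in \<open>K\<close> blocks of length
  \<open>K\<close>, one for each \<open>k\<close> in descending order, which makes the fibre
  argument applicable.\<close>

lemma maximal_inequality_large_values:
  assumes "periodic 1 f" and young: "\<And>x m. f x * real m \<le> \<phi> x + young_weight m"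
  shows "avg (primorial K) (\<lambda>x. of_bool (\<exists>n\<in>punctured_primorials_upto K. avg n f x > 1)) x
    \<le> 4 * avg (primorial K) \<phi> x"
proof -
  define kk where "kk i = K - i div K" for i
  \<comment> \<open>Positions too large to be a puncture of \<open>kk i\<close> repeat the puncture
    0, which is legal because \<open>kk i \<ge> 1\<close> for \<open>i < K * K\<close>.\<close>
  define jj where "jj i = (if i mod K < kk i then i mod K else 0)" for i
  have div_less: "i div K < K" if "i < K * K" for i
    using that by (simp add: less_mult_imp_div_less)
  interpret punctured prime_at K "K * K" kk jj f
  proof
    show "coprime (prime_at i) (prime_at i')" if "i \<noteq> i'" for i i'
      using that prime_prime_at prime_at_inject by (intro primes_coprime) auto
    show "jj i < kk i" if "i < K * K" for i
      using div_less[OF that] by (auto simp: jj_def kk_def)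
    show "kk i \<le> kk i'" if "i' \<le> i" "i < K * K" for i i'
      unfolding kk_def using div_le_mono[OF that(1), of K] by simp
  qed (use assms prime_at_pos in \<open>auto simp: kk_def\<close>)
  have "\<exists>i<K * K. nn i = n" if n: "n \<in> punctured_primorials_upto K" for n
  proof -
    obtain k j where kj: "2 \<le> k" "k \<le> K" "j < k" "n = punctured_primorial k j"
      using n unfolding punctured_primorials_upto_def by blast
    define i where "i = (K - k) * K + j"
    have j: "j < K" using kj by simp
    have "i < (K - k) * K + K" unfolding i_def using j by simp
    also have "\<dots> = (K - k + 1) * K" by simp
    also have "\<dots> \<le> K * K" using kj by (intro mult_right_mono) auto
    finally have "i < K * K" .
    moreover have "kk i = k" "jj i = j" using j kj by (auto simp: i_def kk_def jj_def)
    ultimately show ?thesis using kj by (auto simp: nn_def punctured_primorial_def)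
  qed
  then have "avg (primorial K) (\<lambda>x. of_bool (\<exists>n\<in>punctured_primorials_upto K. avg n f x > 1) :: real) x
    \<le> avg (primorial K) (\<lambda>x. of_bool (\<exists>i<K * K. avg (nn i) f x > 1)) x"
    by (intro avg_mono) (auto simp: of_bool_def)
  also have "\<dots> \<le> 4 * avg (primorial K) \<phi> x"
    using maximal_inequality_pointwise[OF young, of x] by (simp add: P_def primorial_def)
  finally show ?thesis .
qed

text \<open>With \<open>D = 4 * exp 2 * exp 2\<close> this is \<open>2 * 4 * (2 * D)\<close>: 2 for
  discarding values up to 1/2, 4 for the constant of the fibre bound, and \<open>2 * D\<close> for
  the threshold in \<open>young_inequality\<close>.\<close>

definition maximal_const :: real where "maximal_const = 64 * exp 2 * exp 2"

lemma maximal_const_ge_1: "1 \<le> maximal_const"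
  unfolding maximal_const_def using one_le_exp_iff[of 2] mult_mono[of 1 "exp 2" 1 "exp 2 :: real"] by simp

lemma young_weight_nonneg: "0 \<le> young_weight m"
  by (simp add: young_weight_def)

text \<open>For \<open>m\<close> up to the threshold the \<open>Phi\<close> term alone dominates,
  above it the weight does. The assumption on \<open>t\<close> puts the scaled argument above
  1.\<close>

lemma young_inequality_Phi:
  assumes "1 / 2 < t"
  shows "2 * t * real m \<le> Phi (maximal_const * t) / 4 + young_weight m"
proof -
  define z where "z = maximal_const * t"
  define D :: real where "D = 4 * exp 2 * exp 2"
  define T where "T = ln (1 + z) / ln (ln (3 + z))"
  have D1: "1 \<le> D" unfolding D_def using one_le_exp_iff[of 2] mult_mono[of 1 "exp 2" 1 "exp 2 :: real"] by simp
  have z: "z = 8 * D * (2 * t)" by (simp add: z_def D_def maximal_const_def)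
  have tz: "2 * t \<le> z" unfolding z using D1 assms mult_right_mono[of 1 "8 * D" "2 * t"] by simp
  have Phi: "Phi z / 4 = 2 * t * (2 * D * T)"
    unfolding Phi_def T_def by (subst (1) z) (simp add: field_simps)
  show ?thesis
  proof (cases "real m \<le> 2 * D * T")
    case True
    then have "2 * t * real m \<le> Phi z / 4" unfolding Phi using assms by (intro mult_left_mono) auto
    then show ?thesis using young_weight_nonneg[of m] by (simp add: z_def)
  next
    case False
    have "0 \<le> T" unfolding T_def using tz assms lnln_pos[of z] by (intro divide_nonneg_nonneg) auto
    then have "m \<noteq> 0" using False D1 by (auto intro: ccontr)
    then have "z * real m \<le> young_weight m"
      using False tz assms by (intro young_inequality) (auto simp: D_def T_def)
    moreover have "2 * t * real m \<le> z * real m" using tz by (intro mult_right_mono) auto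
    moreover have "0 \<le> Phi z" using tz assms by (intro Phi_nonneg) auto
    ultimately show ?thesis by (simp add: z_def)
  qed
qed

lemma maximal_inequality_fiber:
  assumes "\<And>x. 0 \<le> F x" "periodic 1 F"
  shows "avg (primorial K) (\<lambda>x. of_bool (\<exists>n\<in>punctured_primorials_upto K. avg n F x > 1)) x
    \<le> avg (primorial K) (\<lambda>x. Phi (maximal_const * F x)) x"
proof -
  \<comment> \<open>Values below 1/2 contribute at most 1/2 to an average; this avoids the quadratic range of \<open>Phi\<close>.\<close>
  define f where "f = (\<lambda>x. if F x > 1 / 2 then 2 * F x else 0)"
  define \<phi> where "\<phi> = (\<lambda>x. if F x > 1 / 2 then Phi (maximal_const * F x) / 4 else 0)"
  have young: "f x * real m \<le> \<phi> x + young_weight m" for x m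
    using young_inequality_Phi[of "F x" m] young_weight_nonneg[of m] by (simp add: f_def \<phi>_def)
  have big: "avg n f x > 1" if "n \<in> punctured_primorials_upto K" "avg n F x > 1" for n x
  proof -
    have "n > 0" using that punctured_primorial_pos unfolding punctured_primorials_upto_def by auto
    have "avg n F x \<le> avg n (\<lambda>x. 1 / 2 + 1 / 2 * f x) x"
      using assms by (intro avg_mono) (simp add: f_def)
    also have "\<dots> = 1 / 2 + 1 / 2 * avg n f x"
      using \<open>n > 0\<close> by (simp only: avg_add avg_cmult avg_const)
    finally show ?thesis using that by simp
  qed
  have "avg (primorial K) (\<lambda>x. of_bool (\<exists>n\<in>punctured_primorials_upto K. avg n F x > 1) :: real) x
    \<le> avg (primorial K) (\<lambda>x. of_bool (\<exists>n\<in>punctured_primorials_upto K. avg n f x > 1)) x"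
    using big by (intro avg_mono) (auto simp: of_bool_def)
  also have "\<dots> \<le> 4 * avg (primorial K) \<phi> x"
    by (rule maximal_inequality_large_values) (use assms young in \<open>auto simp: f_def periodic_def\<close>)
  also have "\<dots> = avg (primorial K) (\<lambda>x. 4 * \<phi> x) x" by (simp only: avg_cmult)
  also have "\<dots> \<le> avg (primorial K) (\<lambda>x. Phi (maximal_const * F x)) x"
    using assms maximal_const_ge_1 by (intro avg_mono) (auto simp: \<phi>_def intro!: Phi_nonneg)
  finally show ?thesis .
qed

subsection \<open>The maximal inequality\<close>

lemma space_torus [simp]: "space torus = {0..<1}"
  by (simp add: torus_def)

lemma emeasure_torus_space: "emeasure torus (space torus) = 1"
  by (simp add: torus_def emeasure_restrict_space)

lemma finite_measure_torus: "finite_measure torus"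
  by standard (use emeasure_torus_space in simp)

lemma lebesgue_translation_measurable: "(\<lambda>x::real. x + t) \<in> lebesgue \<rightarrow>\<^sub>M lebesgue"
  using lebesgue_affine_measurable[of "\<lambda>_. 1" t] by (simp add: add.commute)

lemma frac_add_eq:
  assumes "0 \<le> t" "t < 1" "0 \<le> x" "x < (1::real)"
  shows "frac (x + t) = (if x < 1 - t then x + t else x + (t - 1))"
proof (cases "x < 1 - t")
  case False
  then have "\<lfloor>x + t\<rfloor> = 1" using assms by (intro floor_unique) auto
  then show ?thesis using False by (simp add: frac_def)
qed (use assms in \<open>simp add: frac_eq\<close>)

lemma rotation_measurable:
  assumes "0 \<le> t" "t < (1::real)"
  shows "(\<lambda>x. frac (x + t)) \<in> torus \<rightarrow>\<^sub>M torus"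
  unfolding torus_def
proof (rule measurable_restrict_space2)
  have "(\<lambda>x. if x < 1 - t then x + t else x + (t - 1)) \<in> lebesgue \<rightarrow>\<^sub>M lebesgue"
    by (intro measurable_If lebesgue_translation_measurable) auto
  then have "(\<lambda>x. if x < 1 - t then x + t else x + (t - 1)) \<in> lebesgue_on {0..<1} \<rightarrow>\<^sub>M lebesgue"
    by (rule measurable_restrict_space1)
  then show "(\<lambda>x. frac (x + t)) \<in> lebesgue_on {0..<1} \<rightarrow>\<^sub>M lebesgue"
    by (rule measurable_cong[THEN iffD1, rotated]) (use assms in \<open>auto simp: frac_add_eq\<close>)
qed (auto simp: frac_ge_0 frac_lt_1)

text \<open>The rotation translates \<open>{0..<1 - t}\<close> onto \<open>{t..<1}\<close> and the
  remaining piece onto \<open>{0..<t}\<close>, so translation invariance applies to each piece of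
  the extension of \<open>h\<close> by 0.\<close>

lemma nn_integral_rotation:
  assumes t: "0 \<le> t" "t < (1::real)" and h: "h \<in> borel_measurable torus"
  shows "(\<integral>\<^sup>+x. h (frac (x + t)) \<partial>torus) = (\<integral>\<^sup>+x. h x \<partial>torus)"
proof -
  define H where "H x = h x * indicator {0..<1} x" for x
  have [measurable]: "H \<in> borel_measurable lebesgue"
    using h unfolding torus_def H_def by (subst (asm) borel_measurable_restrict_space_iff_ennreal) auto
  have Hm: "(\<lambda>x. H x * indicator {a..<b} x) \<in> borel_measurable lebesgue" for a b
    by (intro borel_measurable_times_ennreal borel_measurable_indicator) auto
  have "(\<integral>\<^sup>+x. h (frac (x + t)) \<partial>torus)
      = (\<integral>\<^sup>+x. h (frac (x + t)) * indicator {0..<1} x \<partial>lebesgue)"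
    unfolding torus_def by (subst nn_integral_restrict_space) auto
  \<comment> \<open>The shape \<open>t + 1 * x\<close> fits the affine substitution rule with slope
    1.\<close>
  also have "\<dots> = (\<integral>\<^sup>+x. H (t + 1 * x) * indicator {t..<1} (t + 1 * x)
       + H ((t - 1) + 1 * x) * indicator {0..<t} ((t - 1) + 1 * x) \<partial>lebesgue)"
    by (intro nn_integral_cong) (use t in \<open>auto simp: H_def frac_add_eq indicator_def add_ac\<close>)
  also have "\<dots> = (\<integral>\<^sup>+x. H (t + 1 * x) * indicator {t..<1} (t + 1 * x) \<partial>lebesgue)
       + (\<integral>\<^sup>+x. H ((t - 1) + 1 * x) * indicator {0..<t} ((t - 1) + 1 * x) \<partial>lebesgue)"
  proof (rule nn_integral_add)
    have *: "(\<lambda>x. G (s + 1 * x)) \<in> borel_measurable lebesgue" 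
      if "G \<in> borel_measurable lebesgue" for G :: "real \<Rightarrow> ennreal" and s
      using measurable_compose[OF lebesgue_translation_measurable[of s] that] by (simp add: add.commute)
    show "(\<lambda>x. H (t + 1 * x) * indicator {t..<1} (t + 1 * x)) \<in> borel_measurable lebesgue"
      by (rule *[of "\<lambda>x. H x * indicator {t..<1} x"]) (rule Hm)
    show "(\<lambda>x. H ((t - 1) + 1 * x) * indicator {0..<t} ((t - 1) + 1 * x)) \<in> borel_measurable lebesgue"
      by (rule *[of "\<lambda>x. H x * indicator {0..<t} x"]) (rule Hm)
  qed
  also have "\<dots> = (\<integral>\<^sup>+x. H x * indicator {t..<1} x \<partial>lebesgue) + (\<integral>\<^sup>+x. H x * indicator {0..<t} x \<partial>lebesgue)"
    using nn_integral_real_affine_lebesgue[OF Hm[of t 1], of 1 t]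
      nn_integral_real_affine_lebesgue[OF Hm[of 0 t], of 1 "t - 1"]
    by simp
  also have "\<dots> = (\<integral>\<^sup>+x. H x * indicator {t..<1} x + H x * indicator {0..<t} x \<partial>lebesgue)"
    by (rule nn_integral_add[symmetric]) (rule Hm)+
  also have "\<dots> = (\<integral>\<^sup>+x. h x * indicator {0..<1} x \<partial>lebesgue)"
    by (intro nn_integral_cong) (use t in \<open>auto simp: H_def indicator_def\<close>)
  also have "\<dots> = (\<integral>\<^sup>+x. h x \<partial>torus)"
    unfolding torus_def by (subst nn_integral_restrict_space) auto
  finally show ?thesis .
qed

lemma distr_rotation:
  assumes t: "0 \<le> t" "t < (1::real)"
  shows "distr torus torus (\<lambda>x. frac (x + t)) = torus"
proof (rule measure_eqI)
  fix A assume "A \<in> sets (distr torus torus (\<lambda>x. frac (x + t)))"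
  then have A: "A \<in> sets torus" by simp
  have "emeasure (distr torus torus (\<lambda>x. frac (x + t))) A
      = (\<integral>\<^sup>+x. indicator A x \<partial>distr torus torus (\<lambda>x. frac (x + t)))"
    using A by simp
  also have "\<dots> = (\<integral>\<^sup>+x. indicator A (frac (x + t)) \<partial>torus)"
    using A rotation_measurable[OF t] by (intro nn_integral_distr) auto
  also have "\<dots> = emeasure torus A"
    using A nn_integral_rotation[OF t, of "indicator A"] by simp
  finally show "emeasure (distr torus torus (\<lambda>x. frac (x + t))) A = emeasure torus A" .
qed simp

section \<open>Riemann means as averages, and passage from fibres to the torus\<close>

lemma riemann_mean_eq_avg: "riemann_mean n f = avg n (\<lambda>x. f (frac x))"
  by (simp add: riemann_mean_def avg_def fun_eq_iff)

lemma periodic_frac: "periodic 1 (\<lambda>x. f (frac x))"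
  by (simp add: periodic_def frac_1_eq)

lemma riemann_mean_measurable:
  assumes "f \<in> borel_measurable torus"
  shows "riemann_mean n f \<in> borel_measurable torus"
  unfolding riemann_mean_def
proof (intro borel_measurable_divide borel_measurable_sum)
  fix k assume "k \<in> {..<n}"
  then show "(\<lambda>x. f (frac (x + real k / real n))) \<in> borel_measurable torus"
    by (intro measurable_compose[OF rotation_measurable assms]) auto
qed auto

text \<open>By rotation invariance all translates have the same integral. Thus an inequality between
  averages on every fibre integrates to one on the torus.\<close>

lemma nn_integral_avg:
  assumes "h \<in> borel_measurable torus" "n > 0" and nonneg: "\<And>x. 0 \<le> h x"
  shows "(\<integral>\<^sup>+x. ennreal (avg n (\<lambda>x. h (frac x)) x) \<partial>torus) = (\<integral>\<^sup>+x. ennreal (h x) \<partial>torus)"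
proof -
  have k: "0 \<le> real k / real n" "real k / real n < 1" if "k \<in> {..<n}" for k
    using that by auto
  have meas: "(\<lambda>x. ennreal (h x / real n)) \<in> borel_measurable torus"
    using assms(1) by (intro measurable_compose[OF _ measurable_ennreal] borel_measurable_divide measurable_const) auto
  have "(\<integral>\<^sup>+x. ennreal (avg n (\<lambda>x. h (frac x)) x) \<partial>torus)
      = (\<integral>\<^sup>+x. (\<Sum>k<n. ennreal (h (frac (x + real k / real n)) / real n)) \<partial>torus)"
    using nonneg by (simp add: avg_def sum_divide_distrib sum_ennreal)
  also have "\<dots> = (\<Sum>k<n. \<integral>\<^sup>+x. ennreal (h (frac (x + real k / real n)) / real n) \<partial>torus)"
  proof (rule nn_integral_sum)
    fix k assume "k \<in> {..<n}"
    then show "(\<lambda>x. ennreal (h (frac (x + real k / real n)) / real n)) \<in> borel_measurable torus"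
      by (intro measurable_compose[OF rotation_measurable meas] k)
  qed
  also have "\<dots> = (\<Sum>k<n. \<integral>\<^sup>+x. ennreal (h x / real n) \<partial>torus)"
    by (intro sum.cong refl nn_integral_rotation k meas)
  also have "\<dots> = (\<integral>\<^sup>+x. (\<Sum>k<n. ennreal (h x / real n)) \<partial>torus)"
    by (intro nn_integral_sum[symmetric] meas)
  also have "\<dots> = (\<integral>\<^sup>+x. ennreal (h x) \<partial>torus)"
    using nonneg assms(2) by (subst sum_ennreal) auto
  finally show ?thesis .
qed

lemma Phi_measurable [measurable]: "Phi \<in> borel_measurable borel"
  unfolding Phi_def[abs_def] by measurable

lemma norm_avg_le: "norm (avg n f x) \<le> avg n (\<lambda>x. norm (f x)) x"
  by (simp add: avg_def norm_divide divide_right_mono norm_sum)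

lemma maximal_inequality_upto:
  assumes f [measurable]: "f \<in> borel_measurable torus" and s: "s > 0"
  shows "emeasure torus {x \<in> space torus. \<exists>n\<in>punctured_primorials_upto K. norm (riemann_mean n f x) > s}
    \<le> (\<integral>\<^sup>+t. ennreal (Phi (maximal_const * norm (f t) / s)) \<partial>torus)"
proof -
  define F where "F y = norm (f (frac y)) / s" for y
  define U where "U = {x \<in> space torus. \<exists>n\<in>punctured_primorials_upto K. norm (riemann_mean n f x) > s}"
  note riemann_mean_measurable[OF f, measurable]
  have U [measurable]: "U \<in> sets torus"
    unfolding U_def using finite_punctured_primorials_upto by measurable
  have F1: "periodic 1 F" unfolding F_def by (rule periodic_frac)
  have big: "avg n F x > 1" if "norm (riemann_mean n f (frac x)) > s" for n x
  proof -
    \<comment> \<open>Riemann means have period 1, so the representative in \<open>{0..<1}\<close>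
      may be replaced by \<open>x\<close>.\<close>
    have "riemann_mean n f (frac x) = riemann_mean n f (x + of_int (- \<lfloor>x\<rfloor>) / real 1)"
      by (simp add: frac_def)
    also have "\<dots> = riemann_mean n f x"
      by (rule periodicD_int) (unfold riemann_mean_eq_avg, intro periodic_avg_other periodic_frac)
    finally have "s < norm (avg n (\<lambda>x. f (frac x)) x)"
      using that by (simp add: riemann_mean_eq_avg)
    also have "\<dots> \<le> avg n (\<lambda>x. norm (f (frac x))) x" by (rule norm_avg_le)
    also have "\<dots> = avg n (\<lambda>x. s * F x) x" using s by (simp add: F_def)
    finally show ?thesis using s by (simp add: avg_cmult)
  qed
  have "emeasure torus U = (\<integral>\<^sup>+x. ennreal (indicator U x) \<partial>torus)"
    using U by (simp add: ennreal_indicator)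
  also have "\<dots> = (\<integral>\<^sup>+x. ennreal (avg (primorial K) (\<lambda>x. indicator U (frac x)) x) \<partial>torus)"
    by (rule nn_integral_avg[symmetric]) (auto simp: primorial_pos)
  also have "\<dots> \<le> (\<integral>\<^sup>+x. ennreal (avg (primorial K) (\<lambda>x. Phi (maximal_const * F x)) x) \<partial>torus)"
  proof (intro nn_integral_mono ennreal_leI)
    fix x
    have "avg (primorial K) (\<lambda>x. indicator U (frac x)) x
      \<le> avg (primorial K) (\<lambda>x. of_bool (\<exists>n\<in>punctured_primorials_upto K. avg n F x > 1) :: real) x"
      using big by (intro avg_mono) (auto simp: U_def indicator_def)
    also have "\<dots> \<le> avg (primorial K) (\<lambda>x. Phi (maximal_const * F x)) x"
      by (rule maximal_inequality_fiber[OF _ F1]) (use s in \<open>simp add: F_def\<close>)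
    finally show "avg (primorial K) (\<lambda>x. indicator U (frac x)) x
      \<le> avg (primorial K) (\<lambda>x. Phi (maximal_const * F x)) x" .
  qed
  also have "\<dots> = (\<integral>\<^sup>+t. ennreal (Phi (maximal_const * (norm (f t) / s))) \<partial>torus)"
    unfolding F_def
    by (rule nn_integral_avg[where h = "\<lambda>t. Phi (maximal_const * (norm (f t) / s))"])
       (use s maximal_const_ge_1 in \<open>auto simp: primorial_pos intro!: Phi_nonneg\<close>)
  finally show ?thesis unfolding U_def by simp
qed

text \<open>The sets for the finite stages increase to the full one, and the bound does not depend
  on the stage.\<close>

lemma maximal_inequality:
  assumes f [measurable]: "f \<in> borel_measurable torus" and s: "s > 0"
  shows "emeasure torus {x \<in> space torus.
           (SUP n \<in> punctured_primorials. ennreal (norm (riemann_mean n f x))) > ennreal s}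
    \<le> (\<integral>\<^sup>+t. ennreal (Phi (maximal_const * norm (f t) / s)) \<partial>torus)"
proof -
  define U where "U K = {x \<in> space torus. \<exists>n\<in>punctured_primorials_upto K. norm (riemann_mean n f x) > s}" for K
  note riemann_mean_measurable[OF f, measurable]
  have U: "range U \<subseteq> sets torus"
  proof (rule image_subsetI)
    show "U K \<in> sets torus" for K
      unfolding U_def using finite_punctured_primorials_upto by measurable
  qed
  have "{x \<in> space torus. (SUP n \<in> punctured_primorials. ennreal (norm (riemann_mean n f x))) > ennreal s}
      = (\<Union>K. U K)"
    using s unfolding punctured_primorials_eq U_def
    by (auto simp: less_SUP_iff ennreal_less_iff)
  also have "emeasure torus \<dots> = (SUP K. emeasure torus (U K))"
    using punctured_primorials_upto_mono
    by (intro SUP_emeasure_incseq[symmetric] U) (fastforce simp: incseq_def U_def)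
  also have "\<dots> \<le> (\<integral>\<^sup>+t. ennreal (Phi (maximal_const * norm (f t) / s)) \<partial>torus)"
    unfolding U_def by (intro SUP_least maximal_inequality_upto f s)
  finally show ?thesis .
qed

subsection \<open>Almost everywhere convergence\<close>

text \<open>For \<open>x > 1\<close> the denominator of \<open>Phi\<close> is at most
  \<open>ln (3 + x) \<le> 2 * ln (1 + x)\<close>. This places the Orlicz class inside the integrable
  functions.\<close>

lemma le_1_plus_Phi:
  assumes "0 \<le> x" shows "x \<le> 1 + 2 * Phi x"
proof (cases "x \<le> 1")
  case True
  then show ?thesis using Phi_nonneg[OF assms] by simp
next
  case False
  define l where "l = ln (3 + x)"
  have l1: "1 < l" unfolding l_def using assms by (rule one_less_ln_3_plus)
  have "3 + x \<le> (1 + x)\<^sup>2" using False mult_mono[of 1 x 1 x] by (simp add: power2_eq_square algebra_simps)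
  then have "l \<le> ln ((1 + x)\<^sup>2)" unfolding l_def using assms by (intro ln_mono) auto
  then have "l \<le> 2 * ln (1 + x)" using assms by (simp add: ln_realpow)
  moreover have "ln l \<le> l" using l1 by (intro less_imp_le ln_less_self) auto
  ultimately have "ln l \<le> 2 * ln (1 + x)" by simp
  then have "x * ln l \<le> x * (2 * ln (1 + x))" using assms by (intro mult_left_mono) auto
  then have "x \<le> 2 * Phi x" using l1 unfolding Phi_def l_def[symmetric] by (simp add: field_simps)
  then show ?thesis by simp
qed

lemma integrable_of_Phi:
  fixes f :: "real \<Rightarrow> 'a::{banach, second_countable_topology}"
  assumes [measurable]: "f \<in> borel_measurable torus" and "integrable torus (\<lambda>x. Phi (norm (f x)))"
  shows "integrable torus f"
proof -
  interpret finite_measure torus by (rule finite_measure_torus)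
  have "integrable torus (\<lambda>x. 1 + 2 * Phi (norm (f x)))" using assms(2) by simp
  then show ?thesis
    by (rule Bochner_Integration.integrable_bound) 
       (use le_1_plus_Phi Phi_nonneg in \<open>auto intro!: AE_I2 simp: abs_of_nonneg add_nonneg_nonneg\<close>)
qed

lemma Phi_mult_le_max:
  assumes "0 \<le> c" "0 \<le> x" shows "Phi (c * x) \<le> (max 1 c)\<^sup>2 * Phi x"
proof -
  have "Phi (c * x) \<le> Phi (max 1 c * x)" using assms by (intro Phi_mono mult_right_mono) auto
  also have "\<dots> \<le> (max 1 c)\<^sup>2 * Phi x" using assms by (intro Phi_mult_le) auto
  finally show ?thesis .
qed

abbreviation (input) punctured_filter :: "nat filter" where
  "punctured_filter \<equiv> inf at_top (principal punctured_primorials)"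

definition riemann_convergent :: "(real \<Rightarrow> complex) \<Rightarrow> bool" where
  "riemann_convergent f \<longleftrightarrow>
     (AE x in torus. ((\<lambda>n. riemann_mean n f x) \<longlongrightarrow> (\<integral>t. f t \<partial>torus)) punctured_filter)"

lemma riemann_mean_diff: "riemann_mean n (\<lambda>x. f x - h x) x = riemann_mean n f x - riemann_mean n h x"
  by (simp add: riemann_mean_def sum_subtractf diff_divide_distrib)

lemma tendsto_Phi_0:
  assumes "(u \<longlongrightarrow> 0) F" "\<And>i. 0 \<le> u i" shows "((\<lambda>i. Phi (u i)) \<longlongrightarrow> 0) F"
proof (rule tendsto_sandwich)
  show "\<forall>\<^sub>F i in F. 0 \<le> Phi (u i)" using assms by (simp add: Phi_nonneg)
  show "\<forall>\<^sub>F i in F. Phi (u i) \<le> (u i)\<^sup>2 / ln (ln 3)" using assms by (simp add: Phi_le_square)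
  have "((\<lambda>i. (u i)\<^sup>2 / ln (ln 3)) \<longlongrightarrow> 0\<^sup>2 / ln (ln 3)) F"
    by (intro tendsto_intros assms) (use one_less_ln_3 in auto)
  then show "((\<lambda>i. (u i)\<^sup>2 / ln (ln 3)) \<longlongrightarrow> 0) F" by simp
qed simp

lemma AE_Phi_scaled_le:
  assumes c: "0 \<le> c" and le: "AE x in torus. norm (u x) \<le> G x"
  shows "AE x in torus. norm (Phi (c * norm (u x))) \<le> (max 1 c)\<^sup>2 * Phi (G x)"
  using le
proof eventually_elim
  case (elim x)
  then have "Phi (c * norm (u x)) \<le> Phi (c * G x)"
    using c by (intro Phi_mono mult_left_mono mult_nonneg_nonneg) auto
  also have "\<dots> \<le> (max 1 c)\<^sup>2 * Phi (G x)"
    using elim c by (intro Phi_mult_le_max) (auto intro: order_trans[OF norm_ge_zero])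
  finally show ?case using c by (simp add: Phi_nonneg)
qed

text \<open>A Banach principle: the maximal inequality for \<open>f - h i\<close> bounds the set
  where some mean of \<open>f\<close> and of \<open>h i\<close> differ by more than
  \<open>s\<close>. Its measure tends to 0, by dominated convergence with a multiple of
  \<open>Phi (G x)\<close> as majorant.\<close>

lemma riemann_convergent_closed:
  fixes h :: "nat \<Rightarrow> real \<Rightarrow> complex"
  assumes f [measurable]: "f \<in> borel_measurable torus" and h [measurable]: "\<And>i. h i \<in> borel_measurable torus"
    and G [measurable]: "G \<in> borel_measurable torus" and f_int: "integrable torus f"
    and G_int: "integrable torus (\<lambda>x. Phi (G x))"
    and le: "\<And>i. AE x in torus. norm (f x - h i x) \<le> G x"
    and lim: "AE x in torus. (\<lambda>i. h i x) \<longlonglongrightarrow> f x"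
    and conv: "\<And>i. riemann_convergent (h i)"
  shows "riemann_convergent f"
proof -
  have diff_lim: "AE x in torus. (\<lambda>i. norm (f x - h i x)) \<longlonglongrightarrow> 0"
    using lim
  proof eventually_elim
    case (elim x)
    from tendsto_norm[OF tendsto_diff[OF tendsto_const[of "f x"] elim]] show ?case by simp
  qed
  have int_lim: "(\<lambda>i. \<integral>t. h i t \<partial>torus) \<longlonglongrightarrow> (\<integral>t. f t \<partial>torus)"
  proof (rule integral_dominated_convergence)
    \<comment> \<open>The domination forces \<open>G\<close> to be nonnegative almost everywhere, so
      integrability of \<open>Phi (G x)\<close> carries over to \<open>G\<close>.\<close>
    have "AE x in torus. 0 \<le> G x"
      using le[of 0] by eventually_elim (auto intro: order_trans[OF norm_ge_zero])
    then have "AE x in torus. norm (Phi (norm (G x))) \<le> norm (Phi (G x))"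
      by eventually_elim simp
    then have "integrable torus (\<lambda>x. Phi (norm (G x)))"
      by (intro Bochner_Integration.integrable_bound[OF G_int]) auto
    then have "integrable torus G" by (rule integrable_of_Phi[OF G])
    then show "integrable torus (\<lambda>x. norm (f x) + G x)" using f_int by auto
    show "AE x in torus. norm (h i x) \<le> norm (f x) + G x" for i
      using le[of i]
    proof eventually_elim
      case (elim x)
      then show ?case using norm_triangle_sub[of "h i x" "f x"] by (simp add: norm_minus_commute)
    qed
  qed (use lim in auto)
  have AE_s: "AE x in torus. \<forall>\<^sub>F n in punctured_filter. dist (riemann_mean n f x) (\<integral>t. f t \<partial>torus) < 3 * s"
    if s: "s > 0" for s
  proof -
    define B where "B i = {x \<in> space torus.
        (SUP n \<in> punctured_primorials. ennreal (norm (riemann_mean n (\<lambda>x. f x - h i x) x))) > ennreal s}" for i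
    define c where "c = maximal_const / s"
    have c: "0 \<le> c" using s maximal_const_ge_1 by (simp add: c_def)
    have B [measurable]: "B i \<in> sets torus" for i
    proof -
      note riemann_mean_measurable[of "\<lambda>x. f x - h i x", measurable]
      show ?thesis unfolding B_def by measurable
    qed
    have bound: "AE x in torus. norm (Phi (c * norm (f x - h i x))) \<le> (max 1 c)\<^sup>2 * Phi (G x)" for i
      by (rule AE_Phi_scaled_le[OF c le])
    have "(\<lambda>i. \<integral>x. Phi (c * norm (f x - h i x)) \<partial>torus) \<longlonglongrightarrow> (\<integral>x. 0 \<partial>torus)"
    proof (rule integral_dominated_convergence)
      show "AE x in torus. (\<lambda>i. Phi (c * norm (f x - h i x))) \<longlonglongrightarrow> 0"
        using diff_lim
      proof eventually_elim
        case (elim x)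
        from tendsto_mult_left[OF elim, of c] show ?case
          using c by (intro tendsto_Phi_0) auto
      qed
    next
      show "integrable torus (\<lambda>x. (max 1 c)\<^sup>2 * Phi (G x))" using G_int by simp
    qed (use bound in auto)
    then have lim0: "(\<lambda>i. \<integral>x. Phi (c * norm (f x - h i x)) \<partial>torus) \<longlonglongrightarrow> 0" by simp
    have emeasure_B: "emeasure torus (B i) \<le> ennreal (\<integral>x. Phi (c * norm (f x - h i x)) \<partial>torus)" for i
    proof -
      have "emeasure torus (B i) \<le> (\<integral>\<^sup>+x. ennreal (Phi (maximal_const * norm (f x - h i x) / s)) \<partial>torus)"
        unfolding B_def by (rule maximal_inequality) (use s in auto)
      also have "\<dots> = (\<integral>\<^sup>+x. ennreal (Phi (c * norm (f x - h i x))) \<partial>torus)"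
        by (simp add: c_def)
      also have "\<dots> = ennreal (\<integral>x. Phi (c * norm (f x - h i x)) \<partial>torus)"
      proof (rule nn_integral_eq_integral)
        show "integrable torus (\<lambda>x. Phi (c * norm (f x - h i x)))"
          by (rule Bochner_Integration.integrable_bound[of _ "\<lambda>x. (max 1 c)\<^sup>2 * Phi (G x)"])
             (use bound[of i] G_int in auto)
      qed (use c in \<open>auto simp: Phi_nonneg\<close>)
      finally show ?thesis .
    qed
    obtain i0 where i0: "\<And>i. i \<ge> i0 \<Longrightarrow> dist (\<integral>t. h i t \<partial>torus) (\<integral>t. f t \<partial>torus) < s"
      using tendstoD[OF int_lim s] unfolding eventually_sequentially by blast
    \<comment> \<open>This set lies in every \<open>B i\<close> with \<open>i \<ge> i0\<close>,
      hence is null. Off it, one good approximation \<open>h i\<close> is available, and that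
      suffices for the estimate by three terms of size \<open>s\<close>.\<close>
    define Z where "Z = (\<Inter>i\<in>{i0..}. B i)"
    have Z [measurable]: "Z \<in> sets torus" unfolding Z_def by measurable
    have "emeasure torus Z = 0"
    proof -
      have "emeasure torus Z \<le> ennreal (\<integral>x. Phi (c * norm (f x - h i x)) \<partial>torus)" if "i \<ge> i0" for i
        by (rule order_trans[OF emeasure_mono emeasure_B[of i]]) (use that in \<open>auto simp: Z_def\<close>)
      moreover have "(\<lambda>i. ennreal (\<integral>x. Phi (c * norm (f x - h i x)) \<partial>torus)) \<longlonglongrightarrow> ennreal 0"
        by (intro tendsto_ennrealI lim0)
      ultimately have "emeasure torus Z \<le> ennreal 0"
        by (intro tendsto_lowerbound[where F = sequentially])
           (auto simp: eventually_sequentially)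
      then show ?thesis by simp
    qed
    then have "AE x in torus. x \<notin> Z"
      using Z by (intro AE_not_in) (auto simp: null_sets_def)
    moreover have "AE x in torus. \<forall>i. ((\<lambda>n. riemann_mean n (h i) x) \<longlongrightarrow> (\<integral>t. h i t \<partial>torus)) punctured_filter"
      using conv unfolding riemann_convergent_def by (simp add: AE_all_countable)
    moreover have "AE x in torus. x \<in> space torus" by (rule AE_space)
    ultimately show ?thesis
    proof eventually_elim
      case (elim x)
      then obtain i where i: "i \<ge> i0" "x \<notin> B i" by (auto simp: Z_def)
      have le_s: "norm (riemann_mean n f x - riemann_mean n (h i) x) \<le> s" if "n \<in> punctured_primorials" for n
      proof (rule ccontr)
        assume "\<not> ?thesis"
        then have "ennreal s < ennreal (norm (riemann_mean n (\<lambda>x. f x - h i x) x))"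
          using s by (simp add: riemann_mean_diff ennreal_less_iff)
        also have "\<dots> \<le> (SUP n \<in> punctured_primorials. ennreal (norm (riemann_mean n (\<lambda>x. f x - h i x) x)))"
          using that by (rule SUP_upper)
        finally show False using i elim by (simp add: B_def)
      qed
      have "\<forall>\<^sub>F n in punctured_filter. dist (riemann_mean n (h i) x) (\<integral>t. h i t \<partial>torus) < s"
        using elim s by (auto intro: tendstoD)
      moreover have "\<forall>\<^sub>F n in punctured_filter. n \<in> punctured_primorials"
        by (simp add: eventually_inf_principal)
      ultimately show ?case
      proof eventually_elim
        case (elim n)
        then show ?case using le_s[of n] i0[OF i(1)]
            dist_triangle[of "riemann_mean n f x" "\<integral>t. f t \<partial>torus" "riemann_mean n (h i) x"]
            dist_triangle[of "riemann_mean n (h i) x" "\<integral>t. f t \<partial>torus" "\<integral>t. h i t \<partial>torus"]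
          by (simp add: dist_norm)
      qed
    qed
  qed
  \<comment> \<open>Only countably many tolerances are used, so that the exceptional null sets can
    be united.\<close>
  have "AE x in torus. \<forall>m. \<forall>\<^sub>F n in punctured_filter. dist (riemann_mean n f x) (\<integral>t. f t \<partial>torus) < 3 * (1 / real (Suc m))"
    unfolding AE_all_countable by (intro allI AE_s) simp
  then show ?thesis unfolding riemann_convergent_def
  proof eventually_elim
    case (elim x)
    show ?case
    proof (rule tendstoI)
      fix e :: real assume "e > 0"
      then obtain m where "1 / real (Suc m) < e / 3" using nat_approx_posE[of "e / 3"] by auto
      then have m: "3 * (1 / real (Suc m)) < e" by simp
      from elim have "\<forall>\<^sub>F n in punctured_filter. dist (riemann_mean n f x) (\<integral>t. f t \<partial>torus) < 3 * (1 / real (Suc m))" ..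
      then show "\<forall>\<^sub>F n in punctured_filter. dist (riemann_mean n f x) (\<integral>t. f t \<partial>torus) < e"
        by eventually_elim (use m in simp)
    qed
  qed
qed

section \<open>Convergence for continuous functions\<close>

lemma integral_riemann_mean:
  assumes f: "integrable torus f" and n: "n > 0"
  shows "integrable torus (riemann_mean n f)" "(\<integral>x. riemann_mean n f x \<partial>torus) = (\<integral>x. f x \<partial>torus)"
proof -
  have int: "integrable torus (\<lambda>x. f (frac (x + real k / real n)))"
    and eq: "(\<integral>x. f (frac (x + real k / real n)) \<partial>torus) = (\<integral>x. f x \<partial>torus)" if "k < n" for k
  proof -
    have k: "0 \<le> real k / real n" "real k / real n < 1" using that by auto
    note T = rotation_measurable[OF k] and D = distr_rotation[OF k]
    show "integrable torus (\<lambda>x. f (frac (x + real k / real n)))"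
      using f integrable_distr[OF T, of f] by (simp add: D)
    show "(\<integral>x. f (frac (x + real k / real n)) \<partial>torus) = (\<integral>x. f x \<partial>torus)"
      using integral_distr[OF T, of f] f by (simp add: D)
  qed
  show "integrable torus (riemann_mean n f)"
    unfolding riemann_mean_def[abs_def]
    by (intro integrable_divide Bochner_Integration.integrable_sum int) auto
  have "(\<integral>x. riemann_mean n f x \<partial>torus) 
      = (\<integral>x. (\<Sum>k<n. f (frac (x + real k / real n))) \<partial>torus) / of_nat n"
    unfolding riemann_mean_def by simp
  also have "(\<integral>x. (\<Sum>k<n. f (frac (x + real k / real n))) \<partial>torus) = of_nat n * (\<integral>x. f x \<partial>torus)"
    using int eq by (subst Bochner_Integration.integral_sum) auto
  finally show "(\<integral>x. riemann_mean n f x \<partial>torus) = (\<integral>x. f x \<partial>torus)" using n by simp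
qed

text \<open>Shifting \<open>x\<close> by a multiple of \<open>1 / n\<close> into
  \<open>[0, 1 / n)\<close> keeps all translates inside \<open>[0, 1)\<close>, where
  \<open>frac\<close> acts as the identity.\<close>

lemma riemann_mean_reduce:
  assumes n: "n > 0"
  obtains x' where "0 \<le> x'" "x' < 1 / real n"
    "riemann_mean n f x = (\<Sum>k<n. f (x' + real k / real n)) / of_nat n"
proof -
  define x' where "x' = x + of_int (- \<lfloor>real n * x\<rfloor>) / real n"
  have x': "x' = frac (real n * x) / real n" using n by (simp add: x'_def frac_def field_simps)
  have "periodic n (riemann_mean n f)"
    unfolding riemann_mean_eq_avg by (intro periodic_avg periodic_frac n)
  then have "riemann_mean n f x = riemann_mean n f x'"
    unfolding x'_def by (rule periodicD_int[symmetric])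
  also have "\<dots> = (\<Sum>k<n. f (x' + real k / real n)) / of_nat n"
  proof -
    have "frac (x' + real k / real n) = x' + real k / real n" if "k < n" for k
    proof -
      have "frac (real n * x) + real k < 1 + real k" using frac_lt_1 by simp
      also have "\<dots> \<le> real n" using that by linarith
      finally have "x' + real k / real n < 1" using n by (simp add: x' field_simps)
      moreover have "0 \<le> x' + real k / real n" using frac_ge_0 by (simp add: x')
      ultimately show ?thesis by (simp add: frac_eq)
    qed
    then show ?thesis by (simp add: riemann_mean_def)
  qed
  finally have "riemann_mean n f x = (\<Sum>k<n. f (x' + real k / real n)) / of_nat n" .
  moreover have "0 \<le> x'" "x' < 1 / real n"
    using n frac_ge_0 frac_lt_1[of "real n * x"] unfolding x' by (auto intro: divide_strict_right_mono)
  ultimately show ?thesis by (intro that)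
qed

text \<open>As a function on the torus, \<open>g\<close> may jump at 0. With both base points in
  \<open>[0, 1 / n)\<close> the compared translates are never separated by the jump, so
  \<open>riemann_mean n g\<close> oscillates little; its integral is that of
  \<open>g\<close>.\<close>

lemma riemann_convergent_continuous:
  assumes cont: "continuous_on UNIV g" and int: "integrable torus g"
  shows "riemann_convergent g"
proof -
  interpret finite_measure torus by (rule finite_measure_torus)
  have "((\<lambda>n. riemann_mean n g x) \<longlongrightarrow> (\<integral>t. g t \<partial>torus)) at_top" for x
  proof (rule tendstoI)
    fix e :: real assume "e > 0"
    then have e2: "e / 2 > 0" by simp
    have "uniformly_continuous_on {0..1} g"
      by (intro compact_uniformly_continuous continuous_on_subset[OF cont]) auto
    then obtain \<delta> where \<delta>: "\<delta> > 0"
      "\<And>u v. u \<in> {0..1} \<Longrightarrow> v \<in> {0..1} \<Longrightarrow> dist v u < \<delta> \<Longrightarrow> dist (g v) (g u) < e / 2"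
      using e2 unfolding uniformly_continuous_on_def by metis
    obtain n0 where n0: "n0 > 0" "1 / real n0 < \<delta>"
      using nat_approx_posE[OF \<delta>(1)] by (metis zero_less_Suc)
    have "dist (riemann_mean n g x) (\<integral>t. g t \<partial>torus) < e" if n: "n \<ge> n0" for n
    proof -
      have npos: "n > 0" using n n0 by simp
      have "1 / real n \<le> 1 / real n0" using n n0 by (intro divide_left_mono) auto
      then have n\<delta>: "1 / real n < \<delta>" using n0 by simp
      have osc: "norm (riemann_mean n g x - riemann_mean n g t) \<le> e / 2" for t
      proof -
        obtain x' where x': "0 \<le> x'" "x' < 1 / real n" 
            "riemann_mean n g x = (\<Sum>k<n. g (x' + real k / real n)) / of_nat n"
          using riemann_mean_reduce[OF npos] .
        obtain t' where t': "0 \<le> t'" "t' < 1 / real n" 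
            "riemann_mean n g t = (\<Sum>k<n. g (t' + real k / real n)) / of_nat n"
          using riemann_mean_reduce[OF npos] .
        have "norm (riemann_mean n g x - riemann_mean n g t)
            = norm (\<Sum>k<n. g (x' + real k / real n) - g (t' + real k / real n)) / real n"
          unfolding x' t' by (simp add: diff_divide_distrib[symmetric] sum_subtractf norm_divide)
        also have "\<dots> \<le> (\<Sum>k<n. e / 2) / real n"
        proof (intro divide_right_mono order_trans[OF norm_sum sum_mono])
          fix k assume "k \<in> {..<n}"
          then have "real k + 1 \<le> real n" by auto
          then have "1 / real n + real k / real n \<le> 1" using npos by (simp add: field_simps)
          then have "x' + real k / real n \<in> {0..1}" "t' + real k / real n \<in> {0..1}"
            using x' t' by auto
          moreover have "dist (x' + real k / real n) (t' + real k / real n) < \<delta>"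
            using x' t' n\<delta> by (auto simp: dist_real_def)
          ultimately show "norm (g (x' + real k / real n) - g (t' + real k / real n)) \<le> e / 2"
            using \<delta>(2) by (simp add: dist_norm less_imp_le)
        qed auto
        also have "\<dots> = e / 2" using npos by simp
        finally show ?thesis .
      qed
      note I = integral_riemann_mean[OF int npos]
      have "riemann_mean n g x - (\<integral>t. g t \<partial>torus) = (\<integral>t. riemann_mean n g x - riemann_mean n g t \<partial>torus)"
        using I emeasure_torus_space by (simp add: measure_def)
      also have "norm \<dots> \<le> (\<integral>t. norm (riemann_mean n g x - riemann_mean n g t) \<partial>torus)"
        by (rule integral_norm_bound)
      also have "\<dots> \<le> (\<integral>t. e / 2 \<partial>torus)"
        by (rule integral_mono) (use I osc in auto)
      also have "\<dots> = e / 2" using emeasure_torus_space by (simp add: measure_def)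
      finally show ?thesis using \<open>e > 0\<close> by (simp add: dist_norm)
    qed
    then show "\<forall>\<^sub>F n in at_top. dist (riemann_mean n g x) (\<integral>t. g t \<partial>torus) < e"
      unfolding eventually_at_top_linorder by blast
  qed
  then show ?thesis unfolding riemann_convergent_def
    by (intro AE_I2 tendsto_mono[OF inf_le1])
qed

section \<open>From bounded functions to the Orlicz class\<close>

lemma integrable_torus_bounded:
  fixes f :: "real \<Rightarrow> 'a::{banach, second_countable_topology}"
  assumes "f \<in> borel_measurable torus" "\<And>x. norm (f x) \<le> C"
  shows "integrable torus f"
proof -
  interpret finite_measure torus by (rule finite_measure_torus)
  show ?thesis by (rule integrable_const_bound[of _ C]) (use assms in auto)
qed

text \<open>Measurability supplies continuous functions converging to \<open>f\<close> almost
  everywhere. Projecting their values onto the ball of radius \<open>C\<close> preserves continuity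
  and convergence and makes \<open>2 * C\<close> a majorant of the differences.\<close>

lemma riemann_convergent_bounded:
  assumes f: "f \<in> borel_measurable torus" and C: "\<And>x. norm (f x) \<le> C"
  shows "riemann_convergent f"
proof -
  interpret finite_measure torus by (rule finite_measure_torus)
  have C0: "0 \<le> C" using order_trans[OF norm_ge_zero C[of 0]] .
  have "f measurable_on {0..<1}"
    using f unfolding torus_def by (subst measurable_on_iff_borel_measurable) auto
  then obtain N g where N: "negligible N" and g: "\<And>i::nat. continuous_on UNIV (g i)"
    and lim: "\<And>x. x \<notin> N \<Longrightarrow> (\<lambda>i. g i x) \<longlonglongrightarrow> (if x \<in> {0..<1} then f x else 0)"
    unfolding measurable_on_def by blast
  let ?S = "cball (0::complex) C"
  define h where "h i x = closest_point ?S (g i x)" for i x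
  have cp: "continuous_on UNIV (closest_point ?S)"
    using C0 by (intro continuous_on_closest_point) auto
  have h_cont: "continuous_on UNIV (h i)" for i
    unfolding h_def using continuous_on_compose2[OF cp g] by auto
  have h_le: "norm (h i x) \<le> C" for i x
    using closest_point_in_set[of ?S "g i x"] C0 unfolding h_def by auto
  have h_meas: "h i \<in> borel_measurable torus" for i
  proof -
    have "h i \<in> borel_measurable lborel"
      using borel_measurable_continuous_onI[OF h_cont] by simp
    then show ?thesis
      unfolding torus_def by (intro measurable_restrict_space1 measurable_completion)
  qed
  have h_lim: "AE x in torus. (\<lambda>i. h i x) \<longlonglongrightarrow> f x"
  proof -
    have "AE x in lebesgue. x \<notin> N"
      using N by (intro AE_not_in) (simp add: negligible_iff_null_sets)
    then have "AE x in torus. x \<notin> N"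
      unfolding torus_def by (subst AE_restrict_space_iff) auto
    moreover have "AE x in torus. x \<in> space torus" by (rule AE_space)
    ultimately show ?thesis
    proof eventually_elim
      case (elim x)
      then have "(\<lambda>i. g i x) \<longlonglongrightarrow> f x" using lim[of x] by simp
      moreover have "isCont (closest_point ?S) (f x)"
        using cp by (simp add: continuous_on_eq_continuous_at)
      ultimately have "(\<lambda>i. h i x) \<longlonglongrightarrow> closest_point ?S (f x)"
        unfolding h_def by (rule isCont_tendsto_compose[rotated])
      then show ?case using C[of x] by (simp add: closest_point_self)
    qed
  qed
  show ?thesis
  proof (rule riemann_convergent_closed[OF f h_meas, of "\<lambda>_. 2 * C"])
    show "AE x in torus. norm (f x - h i x) \<le> 2 * C" for i
      by (rule AE_I2) (use norm_triangle_ineq4 C h_le add_mono in \<open>smt (verit)\<close>)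
    show "riemann_convergent (h i)" for i
      by (rule riemann_convergent_continuous[OF h_cont integrable_torus_bounded[OF h_meas h_le]])
  qed (use h_lim integrable_torus_bounded[OF f C] in auto)
qed

text \<open>Cutting off at height \<open>i\<close> gives bounded functions whose distance from
  \<open>f\<close> is at most \<open>norm (f x)\<close>, an admissible majorant.\<close>

lemma riemann_convergent_orlicz:
  assumes f [measurable]: "f \<in> borel_measurable torus"
    and Phi: "integrable torus (\<lambda>x. Phi (norm (f x)))"
  shows "riemann_convergent f"
proof -
  define h where "h i x = (if norm (f x) \<le> real i then f x else 0)" for i :: nat and x
  have h_meas [measurable]: "h i \<in> borel_measurable torus" for i
    unfolding h_def[abs_def] by measurable
  show ?thesis
  proof (rule riemann_convergent_closed[OF f h_meas, of "\<lambda>x. norm (f x)"])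
    show "AE x in torus. (\<lambda>i. h i x) \<longlonglongrightarrow> f x"
    proof (rule AE_I2)
      fix x
      obtain i0 :: nat where "norm (f x) \<le> real i0" using real_arch_simple by blast
      then have "\<forall>\<^sub>F i in sequentially. h i x = f x"
        unfolding eventually_sequentially by (intro exI[of _ i0]) (auto simp: h_def)
      then show "(\<lambda>i. h i x) \<longlonglongrightarrow> f x" by (rule tendsto_eventually)
    qed
    show "riemann_convergent (h i)" for i
      by (rule riemann_convergent_bounded[OF h_meas, of _ "real i"]) (simp add: h_def)
  qed (use Phi integrable_of_Phi[OF f Phi] in \<open>auto simp: h_def\<close>)
qed

theorem theorem2:
  shows "(\<forall>f \<in> orlicz_class Phi. AE x in torus.
            ((\<lambda>n. riemann_mean n f x) \<longlongrightarrow> (\<integral>t. f t \<partial>torus))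
              (inf at_top (principal punctured_primorials)))
       \<and> (\<exists>c>0. \<forall>f \<in> orlicz_class Phi. \<forall>s::real. s > 0 \<longrightarrow>
            emeasure torus {x \<in> space torus.
                (SUP n \<in> punctured_primorials. ennreal (norm (riemann_mean n f x))) > ennreal s}
              \<le> (\<integral>\<^sup>+t. ennreal (Phi (c * norm (f t) / s)) \<partial>torus))"
proof (intro conjI ballI exI allI impI)
  fix f assume "f \<in> orlicz_class Phi"
  then show "AE x in torus. ((\<lambda>n. riemann_mean n f x) \<longlongrightarrow> (\<integral>t. f t \<partial>torus))
      (inf at_top (principal punctured_primorials))"
    using riemann_convergent_orlicz[of f] by (simp add: orlicz_class_def riemann_convergent_def)
next
  show "0 < maximal_const" using maximal_const_ge_1 by simp
next
  fix f and s :: real assume "f \<in> orlicz_class Phi" "0 < s"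
  then show "emeasure torus {x \<in> space torus.
        (SUP n \<in> punctured_primorials. ennreal (norm (riemann_mean n f x))) > ennreal s}
      \<le> (\<integral>\<^sup>+t. ennreal (Phi (maximal_const * norm (f t) / s)) \<partial>torus)"
    by (intro maximal_inequality) (auto simp: orlicz_class_def)
qed

end
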